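(* Let $\mathbf A=(A_1,\dots,A_n)$ and $\mathbf B=(B_1,\dots,B_n)$ be finite sequences of strictly positive operators in $\mathbb B(\mathscr H)$ such that $0<mA_j\le B_j\le MA_j$ for $1\le j\le n$, for some positive real numbers $m,M$ with $m<1<M$, and such that $\sum_{j=1}^n A_j=\sum_{j=1}^n B_j=I_{\mathscr H}$. Let $f:(0,\infty)\to[0,\infty)$ be operator concave and not identically zero, $t_0\in[m,M]$ and $p\in[0,1]$. Put $$\mu_f=\frac{f(M)-f(m)}{M-m},\qquad \nu_f=\frac{Mf(m)-mf(M)}{M-m},\qquad \gamma_f=\max\left\{\frac{f(t)}{\mu_f t+\nu_f}: m\le t\le M\right\}.$$ Then $$f\left[\sum_{j=1}^n (A_j\natural_{p+1}B_j)+t_0\left(I_{\mathscr H}-\sum_{j=1}^n A_j\natural_p B_j\right)\right]-\gamma_f f(t_0)\left(I_{\mathscr H}-\sum_{j=1}^n A_j\natural_p B_j\right)\ \le\ \gamma_f\, S_p^f(\mathbf A|\mathbf B).$$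
   Context: $\mathscr H$ is a complex Hilbert space with identity operator $I_{\mathscr H}$, and $\le$ is the usual (Loewner) order on self-adjoint operators in $\mathbb B(\mathscr H)$. An operator is strictly positive if it is positive and invertible. A continuous function $f:J\to\mathbb R$ on an interval $J$ is operator concave if $\lambda f(X)+(1-\lambda)f(Y)\le f(\lambda X+(1-\lambda)Y)$ for all $\lambda\in[0,1]$ and all self-adjoint operators $X,Y$ (on any complex Hilbert space) with spectra in $J$. For strictly positive $X,Y$ and $q\in\mathbb R$: $X\natural_q Y=X^{1/2}(X^{-1/2}YX^{-1/2})^qX^{1/2}$ and $S_q^f(X|Y)=X^{1/2}(X^{-1/2}YX^{-1/2})^q f(X^{-1/2}YX^{-1/2})X^{1/2}$. For sequences, $S_q^f(\mathbf A|\mathbf B)=\sum_{j=1}^n S_q^f(A_j|B_j)$. *)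

theory Defs
  imports
    "HOL-Analysis.Analysis"
    "HOL-Library.Function_Algebras"
    "HOL-Computational_Algebra.Polynomial"
begin

section \<open>Complex Hilbert spaces\<close>

text \<open>
  Operator concavity quantifies over Hilbert spaces inside a formula, so a Hilbert space is a
  structure rather than a type: a linear subspace \<open>vecs H\<close> of an abelian group on which the
  complex numbers act by \<open>scl H\<close>, with an inner product \<open>ip H\<close>, linear in its first argument.
  Only the values of \<open>ip H\<close> on \<open>vecs H\<close> matter.
\<close>

record 'a chilbert =
  vecs :: "'a set"
  scl :: "complex \<Rightarrow> 'a \<Rightarrow> 'a"
  ip :: "'a \<Rightarrow> 'a \<Rightarrow> complex"

definition hnorm :: "'a chilbert \<Rightarrow> 'a \<Rightarrow> real" where
  "hnorm H x = sqrt (Re (ip H x x))"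

definition complex_hilbert_space :: "'a::ab_group_add chilbert \<Rightarrow> bool" where
  "complex_hilbert_space H \<longleftrightarrow>
     vector_space (scl H) \<and> module.subspace (scl H) (vecs H) \<and>
     (\<forall>x\<in>vecs H. \<forall>y\<in>vecs H. ip H y x = cnj (ip H x y)) \<and>
     (\<forall>x\<in>vecs H. \<forall>y\<in>vecs H. \<forall>z\<in>vecs H. ip H (x + y) z = ip H x z + ip H y z) \<and>
     (\<forall>c. \<forall>x\<in>vecs H. \<forall>y\<in>vecs H. ip H (scl H c x) y = c * ip H x y) \<and>
     (\<forall>x\<in>vecs H. x \<noteq> 0 \<longrightarrow> 0 < Re (ip H x x)) \<and>
     (\<forall>s :: nat \<Rightarrow> 'a.
        (\<forall>i. s i \<in> vecs H) \<and>
        (\<forall>e>0. \<exists>N. \<forall>i\<ge>N. \<forall>j\<ge>N. hnorm H (s i - s j) < e) \<longrightarrow>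
        (\<exists>l\<in>vecs H. (\<lambda>i. hnorm H (s i - l)) \<longlonglongrightarrow> 0))"


section \<open>Bounded operators\<close>

text \<open>
  Operators on \<open>H\<close> are functions on the underlying type, of which only the values on \<open>vecs H\<close>
  matter. They are added and subtracted pointwise; the identity operator is \<open>id\<close>.
\<close>

definition bounded_op :: "'a::ab_group_add chilbert \<Rightarrow> ('a \<Rightarrow> 'a) \<Rightarrow> bool" where
  "bounded_op H X \<longleftrightarrow>
     (\<forall>x\<in>vecs H. X x \<in> vecs H) \<and>
     (\<forall>x\<in>vecs H. \<forall>y\<in>vecs H. X (x + y) = X x + X y) \<and>
     (\<forall>c. \<forall>x\<in>vecs H. X (scl H c x) = scl H c (X x)) \<and>
     (\<exists>b. \<forall>x\<in>vecs H. hnorm H (X x) \<le> b * hnorm H x)"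

definition op_scale :: "'a chilbert \<Rightarrow> real \<Rightarrow> ('a \<Rightarrow> 'a) \<Rightarrow> 'a \<Rightarrow> 'a" where
  "op_scale H r X = (\<lambda>x. scl H (complex_of_real r) (X x))"

definition selfadjoint_op :: "'a::ab_group_add chilbert \<Rightarrow> ('a \<Rightarrow> 'a) \<Rightarrow> bool" where
  "selfadjoint_op H X \<longleftrightarrow>
     bounded_op H X \<and> (\<forall>x\<in>vecs H. \<forall>y\<in>vecs H. ip H (X x) y = ip H x (X y))"

definition positive_op :: "'a::ab_group_add chilbert \<Rightarrow> ('a \<Rightarrow> 'a) \<Rightarrow> bool" where
  "positive_op H X \<longleftrightarrow> selfadjoint_op H X \<and> (\<forall>x\<in>vecs H. 0 \<le> Re (ip H (X x) x))"

definition loewner_le :: "'a::ab_group_add chilbert \<Rightarrow> ('a \<Rightarrow> 'a) \<Rightarrow> ('a \<Rightarrow> 'a) \<Rightarrow> bool" where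
  "loewner_le H X Y \<longleftrightarrow> selfadjoint_op H X \<and> selfadjoint_op H Y \<and> positive_op H (Y - X)"

definition invertible_op :: "'a::ab_group_add chilbert \<Rightarrow> ('a \<Rightarrow> 'a) \<Rightarrow> bool" where
  "invertible_op H X \<longleftrightarrow>
     bounded_op H X \<and>
     (\<exists>Y. bounded_op H Y \<and> (\<forall>x\<in>vecs H. X (Y x) = x \<and> Y (X x) = x))"

definition strictly_positive_op :: "'a::ab_group_add chilbert \<Rightarrow> ('a \<Rightarrow> 'a) \<Rightarrow> bool" where
  "strictly_positive_op H X \<longleftrightarrow> positive_op H X \<and> invertible_op H X"

definition op_spectrum :: "'a::ab_group_add chilbert \<Rightarrow> ('a \<Rightarrow> 'a) \<Rightarrow> complex set" where
  "op_spectrum H X = {z. \<not> invertible_op H (\<lambda>x. X x - scl H z x)}"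


section \<open>Continuous functional calculus\<close>

definition poly_op :: "'a::ab_group_add chilbert \<Rightarrow> real poly \<Rightarrow> ('a \<Rightarrow> 'a) \<Rightarrow> 'a \<Rightarrow> 'a" where
  "poly_op H p X = (\<Sum>i\<le>degree p. op_scale H (coeff p i) (X ^^ i))"

text \<open>
  For a self-adjoint \<open>X\<close> and \<open>f\<close> continuous on the spectrum, \<open>f(X)\<close> is the limit in operator norm
  of \<open>P\<^sub>k(X)\<close> for real polynomials \<open>P\<^sub>k\<close> that converge to \<open>f\<close> uniformly on the spectrum (which is
  real). The values outside \<open>vecs H\<close> are fixed as \<open>0\<close>, so that \<open>f(X)\<close> is unique as a function.
\<close>

definition is_fun_calc ::
    "'a::ab_group_add chilbert \<Rightarrow> (real \<Rightarrow> real) \<Rightarrow> ('a \<Rightarrow> 'a) \<Rightarrow> ('a \<Rightarrow> 'a) \<Rightarrow> bool" where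
  "is_fun_calc H f X Y \<longleftrightarrow>
     bounded_op H Y \<and> (\<forall>x. x \<notin> vecs H \<longrightarrow> Y x = 0) \<and>
     (\<exists>P :: nat \<Rightarrow> real poly.
        uniform_limit {t. complex_of_real t \<in> op_spectrum H X} (\<lambda>k. poly (P k)) f sequentially \<and>
        (\<forall>e>0. \<forall>\<^sub>F k in sequentially.
           \<forall>x\<in>vecs H. hnorm H (poly_op H (P k) X x - Y x) \<le> e * hnorm H x))"

definition fun_calc ::
    "'a::ab_group_add chilbert \<Rightarrow> (real \<Rightarrow> real) \<Rightarrow> ('a \<Rightarrow> 'a) \<Rightarrow> 'a \<Rightarrow> 'a" where
  "fun_calc H f X = (THE Y. is_fun_calc H f X Y)"

definition op_powr :: "'a::ab_group_add chilbert \<Rightarrow> ('a \<Rightarrow> 'a) \<Rightarrow> real \<Rightarrow> 'a \<Rightarrow> 'a" where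
  "op_powr H X q = fun_calc H (\<lambda>t. t powr q) X"


section \<open>Operator concave functions\<close>

text \<open>
  The Hilbert spaces range over all those with vectors in the type \<open>'u\<close>. With
  \<open>'u = ('i \<Rightarrow> complex)\<close> this covers, up to isomorphism, every Hilbert space whose dimension is
  at most the cardinality of \<open>'i\<close>, since \<open>\<ell>\<^sup>2(S)\<close> is a linear subspace for every set \<open>S\<close> of indices.
\<close>

definition operator_concave ::
    "'u::ab_group_add itself \<Rightarrow> real set \<Rightarrow> (real \<Rightarrow> real) \<Rightarrow> bool" where
  "operator_concave _ J f \<longleftrightarrow>
     is_interval J \<and> continuous_on J f \<and>
     (\<forall>(K :: 'u chilbert) X Y l.
        complex_hilbert_space K \<and>
        selfadjoint_op K X \<and> op_spectrum K X \<subseteq> complex_of_real ` J \<and>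
        selfadjoint_op K Y \<and> op_spectrum K Y \<subseteq> complex_of_real ` J \<and>
        0 \<le> l \<and> l \<le> 1 \<longrightarrow>
        loewner_le K
          (op_scale K l (fun_calc K f X) + op_scale K (1 - l) (fun_calc K f Y))
          (fun_calc K f (op_scale K l X + op_scale K (1 - l) Y)))"


section \<open>Operator means and relative operator entropy\<close>

definition rel_op :: "'a::ab_group_add chilbert \<Rightarrow> ('a \<Rightarrow> 'a) \<Rightarrow> ('a \<Rightarrow> 'a) \<Rightarrow> 'a \<Rightarrow> 'a" where
  "rel_op H X Y = op_powr H X (- 1 / 2) \<circ> Y \<circ> op_powr H X (- 1 / 2)"

definition natural_mean ::
    "'a::ab_group_add chilbert \<Rightarrow> real \<Rightarrow> ('a \<Rightarrow> 'a) \<Rightarrow> ('a \<Rightarrow> 'a) \<Rightarrow> 'a \<Rightarrow> 'a" where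
  "natural_mean H q X Y =
     op_powr H X (1 / 2) \<circ> op_powr H (rel_op H X Y) q \<circ> op_powr H X (1 / 2)"

definition rel_entropy ::
    "'a::ab_group_add chilbert \<Rightarrow> (real \<Rightarrow> real) \<Rightarrow> real \<Rightarrow> ('a \<Rightarrow> 'a) \<Rightarrow> ('a \<Rightarrow> 'a) \<Rightarrow> 'a \<Rightarrow> 'a" where
  "rel_entropy H f q X Y =
     op_powr H X (1 / 2) \<circ> op_powr H (rel_op H X Y) q \<circ> fun_calc H f (rel_op H X Y)
       \<circ> op_powr H X (1 / 2)"

definition rel_entropy_seq ::
    "'a::ab_group_add chilbert \<Rightarrow> (real \<Rightarrow> real) \<Rightarrow> real \<Rightarrow> nat \<Rightarrow>
       (nat \<Rightarrow> 'a \<Rightarrow> 'a) \<Rightarrow> (nat \<Rightarrow> 'a \<Rightarrow> 'a) \<Rightarrow> 'a \<Rightarrow> 'a" where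
  "rel_entropy_seq H f q n A B = (\<Sum>j=1..n. rel_entropy H f q (A j) (B j))"


section \<open>The chord constants of a function on an interval\<close>

definition chord_slope :: "(real \<Rightarrow> real) \<Rightarrow> real \<Rightarrow> real \<Rightarrow> real" where
  "chord_slope f m M = (f M - f m) / (M - m)"

definition chord_intercept :: "(real \<Rightarrow> real) \<Rightarrow> real \<Rightarrow> real \<Rightarrow> real" where
  "chord_intercept f m M = (M * f m - m * f M) / (M - m)"

text \<open>\<open>Max\<close> is only meaningful for finite sets, hence \<open>GREATEST\<close>.\<close>

definition chord_ratio :: "(real \<Rightarrow> real) \<Rightarrow> real \<Rightarrow> real \<Rightarrow> real" where
  "chord_ratio f m M =
     (GREATEST r. r \<in> (\<lambda>t. f t / (chord_slope f m M * t + chord_intercept f m M)) ` {m..M})"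

end

theory Submission
  imports Defs "HOL-Computational_Algebra.Fundamental_Theorem_Algebra"
begin

text \<open>
  Write \<open>C\<^sub>j = A\<^sub>j\<^sup>-\<^sup>1\<^sup>/\<^sup>2 B\<^sub>j A\<^sub>j\<^sup>-\<^sup>1\<^sup>/\<^sup>2\<close>, so that \<open>m \<le> C\<^sub>j \<le> M\<close>, and for a function \<open>h\<close> let \<open>S(h)\<close> be the sum of
  the perspectives \<open>A\<^sub>j\<^sup>1\<^sup>/\<^sup>2 h(C\<^sub>j) A\<^sub>j\<^sup>1\<^sup>/\<^sup>2\<close>. The map \<open>S\<close> is linear and monotone in \<open>h\<close>, and the two
  normalisations say that it sends both the function \<open>1\<close> and the function \<open>t\<close> to the identity. The sums
  of means in the theorem are values \<open>S(t\<^sup>q)\<close>, and the entropy is \<open>S(t\<^sup>p f)\<close>.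

  Put \<open>D = I - S(t\<^sup>p)\<close> and \<open>Z = S(t\<^sup>p\<^sup>+\<^sup>1) + t\<^sub>0 D\<close>. From \<open>t\<^sup>p \<le> (1 - p) + p t\<close> follows \<open>D \<ge> 0\<close>. Therefore
  \<open>Z\<close> is an average of numbers in \<open>[m, M]\<close> with the weights \<open>A\<^sub>j\<^sup>1\<^sup>/\<^sup>2 C\<^sub>j\<^sup>p A\<^sub>j\<^sup>1\<^sup>/\<^sup>2\<close> and \<open>D\<close>, which add up to
  the identity, and \<open>m \<le> Z \<le> M\<close>. By the choice of \<open>\<gamma>\<close> the function \<open>f\<close> is at most \<open>\<gamma>\<close> times its chord
  \<open>\<mu> t + \<nu>\<close> on \<open>[m, M]\<close>, so \<open>f(Z) \<le> \<gamma> (\<mu> Z + \<nu>)\<close>. The chord lies below the concave function \<open>f\<close>, and so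
  \<open>\<mu> Z + \<nu> = S(t\<^sup>p (\<mu> t + \<nu>)) + (\<mu> t\<^sub>0 + \<nu>) D \<le> S(t\<^sup>p f) + f(t\<^sub>0) D\<close>. The two estimates together are the
  theorem. The chord and the constant \<open>\<gamma>\<close> only see \<open>f\<close> as a scalar function: operator concavity is
  used on a one-dimensional space, where it is ordinary concavity
  (\<open>operator_concave_imp_concave\<close>).

  What this argument rests on is that the functional calculus is well defined, linear, multiplicative
  and monotone. The key is \<open>poly_op_nonneg\<close>: a real polynomial \<open>p\<close> that is nonnegative on the
  spectrum of a self-adjoint \<open>X\<close> has a positive value \<open>p(X)\<close>. It combines two facts. The infimum of the
  quadratic form of a self-adjoint operator over unit vectors belongs to its spectrum
  (\<open>spectral_minimum\<close>), and a nonzero polynomial whose value at \<open>X\<close> is singular has a zero in the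
  spectrum of \<open>X\<close> (\<open>poly_op_singular_root\<close>), because it is a product of linear factors and of sums of
  squares \<open>(X - a)\<^sup>2 + b\<^sup>2\<close>, and the latter are bounded below and
  hence invertible (\<open>bounded_below_invertible\<close>). Applied to \<open>e\<^sup>2 - p\<^sup>2\<close> it bounds the norm of \<open>p(X)\<close> by the
  supremum of \<open>\<bar>p\<bar>\<close> on the spectrum, and the continuous calculus follows by approximation.
\<close>

section \<open>Real polynomials and small bounds\<close>

lemma poly_map_of_real_add:
  "poly (map_poly complex_of_real (p + q)) z =
    poly (map_poly of_real p) z + poly (map_poly of_real q) z"
  by (induction p q rule: poly_induct2) (auto simp: map_poly_pCons algebra_simps)

lemma poly_map_of_real_mult:
  "poly (map_poly complex_of_real (p * q)) z =
    poly (map_poly of_real p) z * poly (map_poly of_real q) z"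
proof (induction p)
  case (pCons a p)
  have "poly (map_poly complex_of_real (smult a q)) z = of_real a * poly (map_poly of_real q) z"
    by (induction q) (auto simp: map_poly_pCons algebra_simps)
  then show ?case
    using pCons by (simp add: map_poly_pCons poly_map_of_real_add algebra_simps)
qed simp

text \<open>
  A real polynomial has a linear or a definite quadratic factor. The quadratic one is kept as a
  sum of squares because that form is bounded below on self-adjoint operators as well.
\<close>

lemma real_poly_factor:
  fixes q :: "real poly"
  assumes "degree q > 0"
  obtains a k where "q = [:- a, 1:] * k"
  | a b k where "b \<noteq> 0" "q = ([:- a, 1:] * [:- a, 1:] + [:b\<^sup>2:]) * k"
proof -
  have degree: "degree (map_poly complex_of_real q) = degree q"
    by (rule degree_map_poly) simp
  have "\<exists>z. poly (map_poly complex_of_real q) z = 0"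
  proof (rule fundamental_theorem_of_algebra_alt, rule notI)
    assume "\<exists>a l. a \<noteq> 0 \<and> l = 0 \<and> map_poly complex_of_real q = pCons a l"
    then have "degree (map_poly complex_of_real q) = 0" by auto
    then show False using assms degree by simp
  qed
  then obtain z where z: "poly (map_poly complex_of_real q) z = 0" by blast
  define a b where "a = Re z" and "b = Im z"
  have z_eq: "z = Complex a b" by (simp add: a_def b_def)
  show ?thesis
  proof (cases "b = 0")
    case True
    have "poly (map_poly complex_of_real p) (of_real a) = of_real (poly p a)" for p
      by (induction p) (auto simp: map_poly_pCons)
    moreover have "z = of_real a" using True z_eq by (simp add: complex_eq_iff)
    ultimately have "poly q a = 0" using z by simp
    then obtain k where "q = [:- a, 1:] * k"
      by (auto simp: poly_eq_0_iff_dvd)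
    then show ?thesis using that(1) by blast
  next
    case False
    define d where "d = [:- a, 1:] * [:- a, 1:] + [:b\<^sup>2:]"
    have "degree d = 2" by (simp add: d_def)
    then have "d \<noteq> 0" by auto
    have dz: "poly (map_poly complex_of_real d) z = 0"
      by (simp add: d_def map_poly_pCons z_eq complex_eq_iff algebra_simps power2_eq_square)
    obtain u v where r: "q mod d = [:u, v:]"
    proof -
      have "degree (q mod d) < 2"
        using degree_mod_less[OF \<open>d \<noteq> 0\<close>, of q] \<open>degree d = 2\<close> by auto
      then have "q mod d = [:coeff (q mod d) 0, coeff (q mod d) 1:]"
        by (intro poly_eqI) (auto simp: coeff_pCons coeff_eq_0 split: nat.splits)
      then show ?thesis by (rule that)
    qed
    have "poly (map_poly complex_of_real (d * (q div d) + q mod d)) z = 0"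
      using z by simp
    then have "poly (map_poly complex_of_real [:u, v:]) z = 0"
      unfolding poly_map_of_real_add poly_map_of_real_mult dz r by simp
    then have "of_real u + z * of_real v = 0"
      by (simp add: map_poly_pCons)
    then have "v = 0" "u = 0"
      using False by (auto simp: z_eq complex_eq_iff)
    then have "q = d * (q div d)"
      using r mult_div_mod_eq[of d q] by simp
    then show ?thesis
      using that(2)[OF False] by (simp add: d_def)
  qed
qed

lemma nonpos_if_le_all_multiples:
  fixes a c :: real
  assumes "\<And>e. 0 < e \<Longrightarrow> a \<le> e * c"
  shows "a \<le> 0"
proof (rule ccontr)
  assume "\<not> a \<le> 0"
  then have a: "0 < a" by simp
  define e where "e = a / (2 * (\<bar>c\<bar> + 1))"
  have "0 < e" using a by (simp add: e_def)
  have "e * c \<le> e * (\<bar>c\<bar> + 1)"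
    using \<open>0 < e\<close> by (intro mult_left_mono) auto
  also have "\<dots> = a / 2"
    by (simp add: e_def field_simps)
  finally show False
    using assms[OF \<open>0 < e\<close>] a by simp
qed

section \<open>Inner product geometry\<close>

lemma sum_fun_apply: "(\<Sum>i\<in>I. g i) x = (\<Sum>i\<in>I. g i x)"
  by (induction I rule: infinite_finite_induct) auto

locale hilbert_space =
  fixes H :: "'a::ab_group_add chilbert"
  assumes hilbert: "complex_hilbert_space H"
begin

sublocale scaling: vector_space "scl H"
  using hilbert by (simp add: complex_hilbert_space_def)

lemma subspace_vecs: "module.subspace (scl H) (vecs H)"
  using hilbert by (simp add: complex_hilbert_space_def)

lemma vecs_zero [simp]: "0 \<in> vecs H"
  using subspace_vecs scaling.subspace_0 by blast

lemma vecs_add [simp]: "x \<in> vecs H \<Longrightarrow> y \<in> vecs H \<Longrightarrow> x + y \<in> vecs H"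
  using subspace_vecs scaling.subspace_add by blast

lemma vecs_diff [simp]: "x \<in> vecs H \<Longrightarrow> y \<in> vecs H \<Longrightarrow> x - y \<in> vecs H"
  using subspace_vecs scaling.subspace_diff by blast

lemma vecs_uminus [simp]: "x \<in> vecs H \<Longrightarrow> - x \<in> vecs H"
  using subspace_vecs scaling.subspace_neg by blast

lemma vecs_scl [simp]: "x \<in> vecs H \<Longrightarrow> scl H c x \<in> vecs H"
  using subspace_vecs scaling.subspace_scale by blast

lemma vecs_sum: "(\<And>i. i \<in> I \<Longrightarrow> g i \<in> vecs H) \<Longrightarrow> (\<Sum>i\<in>I. g i) \<in> vecs H"
  by (induction I rule: infinite_finite_induct) auto

lemma ip_cnj: "x \<in> vecs H \<Longrightarrow> y \<in> vecs H \<Longrightarrow> ip H y x = cnj (ip H x y)"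
  using hilbert unfolding complex_hilbert_space_def by blast

lemma ip_add_left: "x \<in> vecs H \<Longrightarrow> y \<in> vecs H \<Longrightarrow> z \<in> vecs H \<Longrightarrow>
    ip H (x + y) z = ip H x z + ip H y z"
  using hilbert unfolding complex_hilbert_space_def by blast

lemma ip_scl_left: "x \<in> vecs H \<Longrightarrow> y \<in> vecs H \<Longrightarrow> ip H (scl H c x) y = c * ip H x y"
  using hilbert unfolding complex_hilbert_space_def by blast

lemma ip_pos: "x \<in> vecs H \<Longrightarrow> x \<noteq> 0 \<Longrightarrow> 0 < Re (ip H x x)"
  using hilbert unfolding complex_hilbert_space_def by blast

lemma ip_add_right: "x \<in> vecs H \<Longrightarrow> y \<in> vecs H \<Longrightarrow> z \<in> vecs H \<Longrightarrow>
    ip H z (x + y) = ip H z x + ip H z y"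
  by (metis complex_cnj_add ip_add_left ip_cnj vecs_add)

lemma ip_scl_right: "x \<in> vecs H \<Longrightarrow> y \<in> vecs H \<Longrightarrow> ip H y (scl H c x) = cnj c * ip H y x"
  by (metis complex_cnj_mult ip_cnj ip_scl_left vecs_scl)

lemma ip_uminus_left: "x \<in> vecs H \<Longrightarrow> y \<in> vecs H \<Longrightarrow> ip H (- x) y = - ip H x y"
  using ip_scl_left[of x y "-1"] by simp

lemma ip_uminus_right: "x \<in> vecs H \<Longrightarrow> y \<in> vecs H \<Longrightarrow> ip H y (- x) = - ip H y x"
  using ip_scl_right[of x y "-1"] by simp

lemma ip_diff_left: "x \<in> vecs H \<Longrightarrow> y \<in> vecs H \<Longrightarrow> z \<in> vecs H \<Longrightarrow>
    ip H (x - y) z = ip H x z - ip H y z"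
  using ip_add_left[of x "- y" z] by (simp add: ip_uminus_left)

lemma ip_diff_right: "x \<in> vecs H \<Longrightarrow> y \<in> vecs H \<Longrightarrow> z \<in> vecs H \<Longrightarrow>
    ip H z (x - y) = ip H z x - ip H z y"
  using ip_add_right[of x "- y" z] by (simp add: ip_uminus_right)

lemma ip_zero_left [simp]: "y \<in> vecs H \<Longrightarrow> ip H 0 y = 0"
  using ip_scl_left[of 0 y 0] by simp

lemma ip_zero_right [simp]: "y \<in> vecs H \<Longrightarrow> ip H y 0 = 0"
  using ip_scl_right[of 0 y 0] by simp

lemmas ip_simps = ip_add_left ip_add_right ip_diff_left ip_diff_right ip_scl_left ip_scl_right
  ip_uminus_left ip_uminus_right

lemma ip_sum_left:
  assumes "\<And>i. i \<in> I \<Longrightarrow> g i \<in> vecs H" "y \<in> vecs H"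
  shows "ip H (\<Sum>i\<in>I. g i) y = (\<Sum>i\<in>I. ip H (g i) y)"
  using assms
  by (induction I rule: infinite_finite_induct) (auto simp: ip_add_left vecs_sum)

lemma ip_self_nonneg: "x \<in> vecs H \<Longrightarrow> 0 \<le> Re (ip H x x)"
  by (cases "x = 0") (auto dest: ip_pos)

lemma hnorm_square: "x \<in> vecs H \<Longrightarrow> (hnorm H x)\<^sup>2 = Re (ip H x x)"
  by (simp add: hnorm_def ip_self_nonneg)

lemma hnorm_nonneg [simp]: "x \<in> vecs H \<Longrightarrow> 0 \<le> hnorm H x"
  by (simp add: hnorm_def ip_self_nonneg)

lemma hnorm_pos: "x \<in> vecs H \<Longrightarrow> x \<noteq> 0 \<Longrightarrow> 0 < hnorm H x"
  by (simp add: hnorm_def ip_pos)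

lemma hnorm_zero [simp]: "hnorm H 0 = 0"
  by (simp add: hnorm_def)

lemma hnorm_scl: "x \<in> vecs H \<Longrightarrow> hnorm H (scl H c x) = cmod c * hnorm H x"
proof -
  assume x: "x \<in> vecs H"
  have "ip H (scl H c x) (scl H c x) = complex_of_real ((cmod c)\<^sup>2) * ip H x x"
    using x complex_norm_square[of c] by (simp add: ip_simps mult.assoc mult.left_commute)
  then have "Re (ip H (scl H c x) (scl H c x)) = (cmod c)\<^sup>2 * Re (ip H x x)"
    by (simp del: of_real_power)
  then show ?thesis
    by (simp add: hnorm_def real_sqrt_mult)
qed

lemma hnorm_uminus: "x \<in> vecs H \<Longrightarrow> hnorm H (- x) = hnorm H x"
  using hnorm_scl[of x "-1"] by simp

lemma hnorm_diff_commute: "x \<in> vecs H \<Longrightarrow> y \<in> vecs H \<Longrightarrow> hnorm H (x - y) = hnorm H (y - x)"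
  using hnorm_uminus[of "x - y"] by simp

text \<open>
  The Cauchy-Schwarz inequality for the semi-inner product of a positive operator. It is needed
  beyond the identity operator because a positive operator with small quadratic form at \<open>x\<close>
  must be small at \<open>x\<close> itself. The form may degenerate at \<open>y\<close>, which is why the step size in
  the proof is not always the minimising one.
\<close>

lemma positive_Cauchy_Schwarz:
  assumes T: "positive_op H T" and x: "x \<in> vecs H" and y: "y \<in> vecs H"
  shows "(cmod (ip H (T x) y))\<^sup>2 \<le> Re (ip H (T x) x) * Re (ip H (T y) y)"
proof -
  define a b c where "a = Re (ip H (T x) x)" and "b = ip H (T x) y" and "c = Re (ip H (T y) y)"
  have bd: "bounded_op H T" and sa: "\<And>u v. u \<in> vecs H \<Longrightarrow> v \<in> vecs H \<Longrightarrow> ip H (T u) v = ip H u (T v)"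
    and pos: "\<And>u. u \<in> vecs H \<Longrightarrow> 0 \<le> Re (ip H (T u) u)"
    using T by (auto simp: positive_op_def selfadjoint_op_def)
  have TV: "T u \<in> vecs H" if "u \<in> vecs H" for u
    using bd that by (auto simp: bounded_op_def)
  have Tadd: "T (u + v) = T u + T v" if "u \<in> vecs H" "v \<in> vecs H" for u v
    using bd that by (auto simp: bounded_op_def)
  have Tscl: "T (scl H z u) = scl H z (T u)" if "u \<in> vecs H" for z u
    using bd that by (auto simp: bounded_op_def)
  have quadratic: "0 \<le> a - 2 * s * (cmod b)\<^sup>2 + s\<^sup>2 * (cmod b)\<^sup>2 * c" for s :: real
  proof -
    let ?z = "- (of_real s * b)"
    have yx: "ip H (T y) x = cnj b"
      using x y TV ip_cnj[of "T x" y] sa[of y x] unfolding b_def by simp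
    have expand: "ip H (T (x + scl H z y)) (x + scl H z y) =
      ip H (T x) x + cnj z * b + z * cnj b + (z * cnj z) * ip H (T y) y" for z
      using x y TV by (simp add: Tadd Tscl ip_simps yx b_def[symmetric] algebra_simps)
    have "ip H (T (x + scl H ?z y)) (x + scl H ?z y) = ip H (T x) x - of_real (2 * s) * (b * cnj b)
        + of_real (s\<^sup>2) * (b * cnj b) * ip H (T y) y"
      unfolding expand by (simp add: algebra_simps power2_eq_square)
    also have "b * cnj b = of_real ((cmod b)\<^sup>2)"
      by (rule complex_norm_square[symmetric])
    finally have "Re (ip H (T (x + scl H ?z y)) (x + scl H ?z y)) =
        a - 2 * s * (cmod b)\<^sup>2 + s\<^sup>2 * (cmod b)\<^sup>2 * c"
      unfolding a_def c_def by (simp del: of_real_power of_real_mult add: of_real_mult[symmetric])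
    then show ?thesis
      using pos[of "x + scl H ?z y"] x y by simp
  qed
  have "(cmod b)\<^sup>2 \<le> a * c"
  proof (cases "c = 0")
    case True
    have "b = 0"
    proof (rule ccontr)
      assume "b \<noteq> 0"
      then have "0 < (cmod b)\<^sup>2" by simp
      then show False
        using quadratic[of "(a + 1) / (2 * (cmod b)\<^sup>2)"] True by (simp add: field_simps)
    qed
    then show ?thesis by (simp add: True)
  next
    case False
    then have "0 < c" using pos[OF y] by (simp add: c_def)
    then show ?thesis
      using quadratic[of "1 / c"] by (simp add: field_simps power2_eq_square)
  qed
  then show ?thesis by (simp add: a_def b_def c_def)
qed

lemma bounded_op_id: "bounded_op H id"
  by (auto simp: bounded_op_def intro: exI[of _ 1])

lemma positive_op_id: "positive_op H id"
  by (auto simp: positive_op_def selfadjoint_op_def bounded_op_id ip_self_nonneg)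

lemma Cauchy_Schwarz:
  assumes x: "x \<in> vecs H" and y: "y \<in> vecs H"
  shows "cmod (ip H x y) \<le> hnorm H x * hnorm H y"
proof -
  have "(cmod (ip H x y))\<^sup>2 \<le> (hnorm H x * hnorm H y)\<^sup>2"
    using positive_Cauchy_Schwarz[OF positive_op_id x y] x y
    by (simp add: power_mult_distrib hnorm_square)
  then show ?thesis
    by (rule power2_le_imp_le) (use x y in simp)
qed

lemma hnorm_add_square:
  "x \<in> vecs H \<Longrightarrow> y \<in> vecs H \<Longrightarrow>
    (hnorm H (x + y))\<^sup>2 = (hnorm H x)\<^sup>2 + 2 * Re (ip H x y) + (hnorm H y)\<^sup>2"
  using ip_cnj[of x y] by (simp add: hnorm_square ip_simps)

lemma hnorm_triangle:
  assumes x: "x \<in> vecs H" and y: "y \<in> vecs H"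
  shows "hnorm H (x + y) \<le> hnorm H x + hnorm H y"
proof (rule power2_le_imp_le)
  have "Re (ip H x y) \<le> hnorm H x * hnorm H y"
    using Cauchy_Schwarz[OF x y] complex_Re_le_cmod[of "ip H x y"] by linarith
  then show "(hnorm H (x + y))\<^sup>2 \<le> (hnorm H x + hnorm H y)\<^sup>2"
    unfolding hnorm_add_square[OF x y] by (simp add: power2_sum)
qed (use x y in simp)

lemma hnorm_triangle_diff:
  assumes "x \<in> vecs H" "y \<in> vecs H" "z \<in> vecs H"
  shows "hnorm H (x - z) \<le> hnorm H (x - y) + hnorm H (y - z)"
  using hnorm_triangle[of "x - y" "y - z"] assms by simp

lemma eq_if_hnorm_small:
  assumes "x \<in> vecs H" "y \<in> vecs H" and "\<And>e. 0 < e \<Longrightarrow> hnorm H (x - y) \<le> e"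
  shows "x = y"
proof (rule ccontr)
  assume "x \<noteq> y"
  then have "0 < hnorm H (x - y)"
    using assms hnorm_pos[of "x - y"] by simp
  then show False
    using assms(3)[of "hnorm H (x - y) / 2"] by simp
qed

lemma hnorm_complete:
  assumes "\<And>i. s i \<in> vecs H"
    and "\<And>e. 0 < e \<Longrightarrow> \<exists>N. \<forall>i\<ge>N. \<forall>j\<ge>N. hnorm H (s i - s j) < e"
  obtains l where "l \<in> vecs H" "(\<lambda>i. hnorm H (s i - l)) \<longlonglongrightarrow> 0"
  using hilbert assms unfolding complex_hilbert_space_def by blast


section \<open>Algebra of bounded operators\<close>

lemma bounded_op_vecs: "bounded_op H X \<Longrightarrow> x \<in> vecs H \<Longrightarrow> X x \<in> vecs H"
  by (auto simp: bounded_op_def)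

lemma bounded_op_add: "bounded_op H X \<Longrightarrow> x \<in> vecs H \<Longrightarrow> y \<in> vecs H \<Longrightarrow> X (x + y) = X x + X y"
  by (auto simp: bounded_op_def)

lemma bounded_op_scl: "bounded_op H X \<Longrightarrow> x \<in> vecs H \<Longrightarrow> X (scl H c x) = scl H c (X x)"
  by (auto simp: bounded_op_def)

lemma bounded_opI:
  assumes "\<And>x. x \<in> vecs H \<Longrightarrow> X x \<in> vecs H"
    and "\<And>x y. x \<in> vecs H \<Longrightarrow> y \<in> vecs H \<Longrightarrow> X (x + y) = X x + X y"
    and "\<And>c x. x \<in> vecs H \<Longrightarrow> X (scl H c x) = scl H c (X x)"
    and "\<And>x. x \<in> vecs H \<Longrightarrow> hnorm H (X x) \<le> b * hnorm H x"
  shows "bounded_op H X"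
  using assms unfolding bounded_op_def by blast

lemma bounded_op_diff:
  "bounded_op H X \<Longrightarrow> x \<in> vecs H \<Longrightarrow> y \<in> vecs H \<Longrightarrow> X (x - y) = X x - X y"
  using bounded_op_add[of X x "scl H (-1) y"] bounded_op_scl[of X y "-1"] by simp

lemma bounded_op_bound:
  assumes "bounded_op H X"
  obtains b where "0 < b" "\<And>x. x \<in> vecs H \<Longrightarrow> hnorm H (X x) \<le> b * hnorm H x"
proof -
  obtain b where b: "\<forall>x\<in>vecs H. hnorm H (X x) \<le> b * hnorm H x"
    using assms unfolding bounded_op_def by blast
  have "hnorm H (X x) \<le> max b 1 * hnorm H x" if "x \<in> vecs H" for x
    using bspec[OF b that] mult_right_mono[of b "max b 1" "hnorm H x"] that by simp
  then show ?thesis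
    by (rule that[rotated]) auto
qed

lemma bounded_op_plus:
  assumes X: "bounded_op H X" and Y: "bounded_op H Y"
  shows "bounded_op H (X + Y)"
proof -
  obtain b where b: "\<And>x. x \<in> vecs H \<Longrightarrow> hnorm H (X x) \<le> b * hnorm H x"
    using bounded_op_bound[OF X] by blast
  obtain c where c: "\<And>x. x \<in> vecs H \<Longrightarrow> hnorm H (Y x) \<le> c * hnorm H x"
    using bounded_op_bound[OF Y] by blast
  have "hnorm H (X x + Y x) \<le> (b + c) * hnorm H x" if "x \<in> vecs H" for x
    using b[OF that] c[OF that] that hnorm_triangle[of "X x" "Y x"] X Y
    by (simp add: bounded_op_vecs distrib_right)
  then show ?thesis
    by (intro bounded_opI[where b = "b + c"])
      (auto simp: bounded_op_vecs bounded_op_add bounded_op_scl X Y algebra_simps)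
qed

lemma bounded_op_op_scale:
  assumes X: "bounded_op H X"
  shows "bounded_op H (op_scale H r X)"
proof -
  obtain b where b: "\<And>x. x \<in> vecs H \<Longrightarrow> hnorm H (X x) \<le> b * hnorm H x"
    using bounded_op_bound[OF X] by blast
  have "hnorm H (op_scale H r X x) \<le> (\<bar>r\<bar> * b) * hnorm H x" if "x \<in> vecs H" for x
    using b[OF that] mult_left_mono[OF b[OF that], of "\<bar>r\<bar>"] that X
    by (simp add: op_scale_def hnorm_scl bounded_op_vecs mult.assoc)
  then show ?thesis
    by (intro bounded_opI[where b = "\<bar>r\<bar> * b"])
      (auto simp: op_scale_def bounded_op_vecs bounded_op_add bounded_op_scl X
        scaling.scale_right_distrib mult.commute)
qed

lemma minus_eq_plus_op_scale: "X - Y = X + op_scale H (-1) Y"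
  by (rule ext) (simp add: op_scale_def)

lemma bounded_op_comp:
  assumes X: "bounded_op H X" and Y: "bounded_op H Y"
  shows "bounded_op H (X \<circ> Y)"
proof -
  obtain b where b: "0 < b" "\<And>x. x \<in> vecs H \<Longrightarrow> hnorm H (X x) \<le> b * hnorm H x"
    using bounded_op_bound[OF X] by blast
  obtain c where c: "\<And>x. x \<in> vecs H \<Longrightarrow> hnorm H (Y x) \<le> c * hnorm H x"
    using bounded_op_bound[OF Y] by blast
  have "hnorm H ((X \<circ> Y) x) \<le> (b * c) * hnorm H x" if "x \<in> vecs H" for x
  proof -
    have "hnorm H (X (Y x)) \<le> b * hnorm H (Y x)"
      using b(2) bounded_op_vecs[OF Y that] by blast
    also have "\<dots> \<le> b * (c * hnorm H x)"
      using c[OF that] b(1) by (intro mult_left_mono) auto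
    finally show ?thesis by (simp add: mult.assoc)
  qed
  then show ?thesis
    by (intro bounded_opI[where b = "b * c"])
      (auto simp: bounded_op_vecs bounded_op_add bounded_op_scl X Y)
qed

lemma selfadjoint_opD:
  assumes "selfadjoint_op H X"
  shows "bounded_op H X" and "\<And>x y. x \<in> vecs H \<Longrightarrow> y \<in> vecs H \<Longrightarrow> ip H (X x) y = ip H x (X y)"
  using assms by (auto simp: selfadjoint_op_def)

lemma selfadjoint_op_vecs: "selfadjoint_op H X \<Longrightarrow> x \<in> vecs H \<Longrightarrow> X x \<in> vecs H"
  by (simp add: selfadjoint_opD bounded_op_vecs)

lemma selfadjoint_op_id: "selfadjoint_op H id"
  using positive_op_id by (simp add: positive_op_def)

lemma selfadjoint_op_zero: "selfadjoint_op H 0"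
  by (auto simp: selfadjoint_op_def bounded_op_def intro: exI[of _ 0])

lemma selfadjoint_op_plus:
  "selfadjoint_op H X \<Longrightarrow> selfadjoint_op H Y \<Longrightarrow> selfadjoint_op H (X + Y)"
  by (auto simp: selfadjoint_op_def bounded_op_plus ip_simps bounded_op_vecs)

lemma selfadjoint_op_op_scale: "selfadjoint_op H X \<Longrightarrow> selfadjoint_op H (op_scale H r X)"
  using bounded_op_op_scale
  by (auto simp: selfadjoint_op_def op_scale_def ip_simps bounded_op_vecs)

lemma selfadjoint_op_minus:
  "selfadjoint_op H X \<Longrightarrow> selfadjoint_op H Y \<Longrightarrow> selfadjoint_op H (X - Y)"
  unfolding minus_eq_plus_op_scale by (intro selfadjoint_op_plus selfadjoint_op_op_scale)

lemma selfadjoint_op_sum: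
  "(\<And>i. i \<in> I \<Longrightarrow> selfadjoint_op H (g i)) \<Longrightarrow> selfadjoint_op H (\<Sum>i\<in>I. g i)"
  by (induction I rule: infinite_finite_induct)
    (auto intro: selfadjoint_op_zero selfadjoint_op_plus simp: zero_fun_def[symmetric])

lemma selfadjoint_op_comp:
  assumes "selfadjoint_op H X" "selfadjoint_op H Y"
    and "\<And>x. x \<in> vecs H \<Longrightarrow> X (Y x) = Y (X x)"
  shows "selfadjoint_op H (X \<circ> Y)"
  using assms by (auto simp: selfadjoint_op_def bounded_op_comp bounded_op_vecs)

lemma selfadjoint_op_conjugation:
  "selfadjoint_op H S \<Longrightarrow> selfadjoint_op H X \<Longrightarrow> selfadjoint_op H (S \<circ> X \<circ> S)"
  by (auto simp: selfadjoint_op_def bounded_op_comp bounded_op_vecs)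

lemma selfadjoint_op_cong:
  assumes "selfadjoint_op H X" "\<And>x. x \<in> vecs H \<Longrightarrow> Y x = X x"
  shows "selfadjoint_op H Y"
  using assms by (auto simp: selfadjoint_op_def bounded_op_def)

lemma quad_minus:
  "selfadjoint_op H X \<Longrightarrow> selfadjoint_op H Y \<Longrightarrow> x \<in> vecs H \<Longrightarrow>
    Re (ip H ((X - Y) x) x) = Re (ip H (X x) x) - Re (ip H (Y x) x)"
  by (simp add: ip_simps selfadjoint_op_vecs)

lemma quad_plus:
  "selfadjoint_op H X \<Longrightarrow> selfadjoint_op H Y \<Longrightarrow> x \<in> vecs H \<Longrightarrow>
    Re (ip H ((X + Y) x) x) = Re (ip H (X x) x) + Re (ip H (Y x) x)"
  by (simp add: ip_simps selfadjoint_op_vecs)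

lemma quad_op_scale:
  "selfadjoint_op H X \<Longrightarrow> x \<in> vecs H \<Longrightarrow>
    Re (ip H (op_scale H r X x) x) = r * Re (ip H (X x) x)"
  by (simp add: op_scale_def ip_simps selfadjoint_op_vecs)

lemma quad_sum:
  "(\<And>i. i \<in> I \<Longrightarrow> selfadjoint_op H (g i)) \<Longrightarrow> x \<in> vecs H \<Longrightarrow>
    Re (ip H ((\<Sum>i\<in>I. g i) x) x) = (\<Sum>i\<in>I. Re (ip H (g i x) x))"
  by (simp add: sum_fun_apply ip_sum_left selfadjoint_op_vecs)

lemma quad_id: "x \<in> vecs H \<Longrightarrow> Re (ip H (id x) x) = (hnorm H x)\<^sup>2"
  by (simp add: hnorm_square)

lemma loewner_le_iff:
  "loewner_le H X Y \<longleftrightarrow> selfadjoint_op H X \<and> selfadjoint_op H Y \<and>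
    (\<forall>x\<in>vecs H. Re (ip H (X x) x) \<le> Re (ip H (Y x) x))"
  using quad_minus selfadjoint_op_minus
  by (auto simp: loewner_le_def positive_op_def simp del: fun_diff_def minus_apply)

section \<open>Invertibility and the spectrum\<close>

lemma invertible_op_cong:
  assumes "invertible_op H X" "\<And>x. x \<in> vecs H \<Longrightarrow> Y x = X x"
  shows "invertible_op H Y"
proof -
  obtain Z where Z: "bounded_op H Z" "\<And>x. x \<in> vecs H \<Longrightarrow> X (Z x) = x \<and> Z (X x) = x"
    and X: "bounded_op H X"
    using assms(1) unfolding invertible_op_def by blast
  have "bounded_op H Y"
    using X assms(2) by (auto simp: bounded_op_def)
  moreover have "Y (Z x) = x \<and> Z (Y x) = x" if "x \<in> vecs H" for x
    using Z(2)[OF that] assms(2) bounded_op_vecs[OF Z(1) that] that by simp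
  ultimately show ?thesis
    using Z(1) unfolding invertible_op_def by blast
qed

lemma invertible_op_comp:
  assumes "invertible_op H X" "invertible_op H Y"
  shows "invertible_op H (X \<circ> Y)"
proof -
  obtain X' where X': "bounded_op H X'" "\<And>x. x \<in> vecs H \<Longrightarrow> X (X' x) = x \<and> X' (X x) = x"
    and X: "bounded_op H X"
    using assms(1) unfolding invertible_op_def by blast
  obtain Y' where Y': "bounded_op H Y'" "\<And>x. x \<in> vecs H \<Longrightarrow> Y (Y' x) = x \<and> Y' (Y x) = x"
    and Y: "bounded_op H Y"
    using assms(2) unfolding invertible_op_def by blast
  have "\<forall>x\<in>vecs H. (X \<circ> Y) ((Y' \<circ> X') x) = x \<and> (Y' \<circ> X') ((X \<circ> Y) x) = x"
  proof
    fix x assume x: "x \<in> vecs H"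
    show "(X \<circ> Y) ((Y' \<circ> X') x) = x \<and> (Y' \<circ> X') ((X \<circ> Y) x) = x"
      using X'(2)[OF x] Y'(2)[OF bounded_op_vecs[OF X'(1) x]] Y'(2)[OF x]
        X'(2)[OF bounded_op_vecs[OF Y x]] by simp
  qed
  then show ?thesis
    unfolding invertible_op_def
    by (intro conjI exI[of _ "Y' \<circ> X'"]) (auto intro: bounded_op_comp X X'(1) Y Y'(1))
qed

lemma geometric_steps_converge:
  assumes s: "\<And>i. s i \<in> vecs H" and step: "\<And>i. hnorm H (s (Suc i) - s i) \<le> r ^ i * c"
    and r: "0 \<le> r" "r < 1"
  obtains l where "l \<in> vecs H" "(\<lambda>i. hnorm H (s i - l)) \<longlonglongrightarrow> 0"
proof -
  have c: "0 \<le> c"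
    using step[of 0] order_trans[OF hnorm_nonneg[of "s (Suc 0) - s 0"]] s by simp
  have tail: "hnorm H (s (i + k) - s i) \<le> (r ^ i - r ^ (i + k)) * (c / (1 - r))" for i k
  proof (induction k)
    case (Suc k)
    have "hnorm H (s (i + Suc k) - s i) \<le> r ^ (i + k) * c + (r ^ i - r ^ (i + k)) * (c / (1 - r))"
      using hnorm_triangle_diff[of "s (i + Suc k)" "s (i + k)" "s i"] step[of "i + k"] Suc s
      by simp
    also have "r ^ (i + k) * c = (r ^ (i + k) - r ^ (i + Suc k)) * (c / (1 - r))"
      using r by (simp add: field_simps)
    finally show ?case
      unfolding left_diff_distrib by linarith
  qed simp
  have bound: "hnorm H (s j - s i) \<le> r ^ i * (c / (1 - r))" if "i \<le> j" for i j
  proof -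
    have "(r ^ i - r ^ j) * (c / (1 - r)) \<le> r ^ i * (c / (1 - r))"
      using r c by (intro mult_right_mono) auto
    then show ?thesis
      using tail[of i "j - i"] that by simp
  qed
  have "(\<lambda>i. r ^ i * (c / (1 - r))) \<longlonglongrightarrow> 0 * (c / (1 - r))"
    using r by (intro tendsto_intros LIMSEQ_power_zero) simp
  then have small: "\<exists>N. \<forall>i\<ge>N. r ^ i * (c / (1 - r)) < e" if "0 < e" for e
    using order_tendstoD(2)[of _ "0 * (c / (1 - r))" sequentially e] that
    by (simp add: eventually_sequentially)
  have "\<exists>N. \<forall>i\<ge>N. \<forall>j\<ge>N. hnorm H (s i - s j) < e" if e: "0 < e" for e
  proof -
    obtain N where N: "\<And>i. i \<ge> N \<Longrightarrow> r ^ i * (c / (1 - r)) < e"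
      using small[OF e] by blast
    have "hnorm H (s i - s j) < e" if "i \<ge> N" "j \<ge> N" for i j
    proof (cases "i \<le> j")
      case True
      then show ?thesis
        using bound[OF True] N[OF that(1)] hnorm_diff_commute[of "s i" "s j"] s by simp
    next
      case False
      then show ?thesis
        using bound[of j i] N[OF that(2)] by simp
    qed
    then show ?thesis by blast
  qed
  then show ?thesis
    using hnorm_complete[of s] s that by blast
qed

text \<open>
  The only place, besides the construction of the functional calculus, where completeness enters:
  \<open>T x = y\<close> is solved by the damped iteration \<open>x \<mapsto> x - r (T x - y)\<close>, which contracts because \<open>T\<close>
  is bounded below as a form.
\<close>

lemma bounded_below_invertible:
  assumes T: "selfadjoint_op H T" and c: "0 < c"
    and below: "\<And>x. x \<in> vecs H \<Longrightarrow> c * (hnorm H x)\<^sup>2 \<le> Re (ip H (T x) x)"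
  shows "invertible_op H T"
proof -
  have bd: "bounded_op H T" using T by (simp add: selfadjoint_opD)
  note TV = bounded_op_vecs[OF bd]
  obtain K where K: "0 < K" "\<And>x. x \<in> vecs H \<Longrightarrow> hnorm H (T x) \<le> K * hnorm H x"
    using bounded_op_bound[OF bd] by blast
  \<comment> \<open>Enlarging the bound makes the contraction factor below nonnegative.\<close>
  define L where "L = K + c"
  have L: "0 < L" "c \<le> L" "\<And>x. x \<in> vecs H \<Longrightarrow> hnorm H (T x) \<le> L * hnorm H x"
  proof -
    fix x assume "x \<in> vecs H"
    then show "hnorm H (T x) \<le> L * hnorm H x"
      using K(2)[of x] c by (simp add: L_def distrib_right add_increasing2)
  qed (use K c in \<open>auto simp: L_def\<close>)
  define \<rho> where "\<rho> = c / L\<^sup>2"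
  define q where "q = 1 - c\<^sup>2 / L\<^sup>2"
  have q: "0 \<le> q" "q < 1"
    using L(1,2) c by (auto simp: q_def power_mono)
  define E where "E = (\<lambda>x. x - scl H (of_real \<rho>) (T x))"
  have EV: "E x \<in> vecs H" if "x \<in> vecs H" for x
    using that TV by (simp add: E_def)
  have Ediff: "E x - E y = E (x - y)" if "x \<in> vecs H" "y \<in> vecs H" for x y
    using that by (simp add: E_def bounded_op_diff[OF bd] algebra_simps
        scaling.scale_right_diff_distrib)
  have contract: "hnorm H (E x) \<le> sqrt q * hnorm H x" if x: "x \<in> vecs H" for x
  proof -
    have re: "Re (ip H x (T x)) = Re (ip H (T x) x)"
      using ip_cnj[of x "T x"] x TV by simp
    have "(hnorm H (E x))\<^sup>2 = (hnorm H x)\<^sup>2 - 2 * \<rho> * Re (ip H (T x) x) + \<rho>\<^sup>2 * (hnorm H (T x))\<^sup>2"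
    proof -
      have "(hnorm H (E x))\<^sup>2 = Re (ip H (E x) (E x))"
        using EV[OF x] by (rule hnorm_square)
      also have "\<dots> = Re (ip H x x) - 2 * \<rho> * Re (ip H (T x) x) + \<rho>\<^sup>2 * Re (ip H (T x) (T x))"
        using x TV re by (simp add: E_def ip_simps algebra_simps power2_eq_square)
      finally show ?thesis
        using x TV by (simp add: hnorm_square)
    qed
    also have "\<dots> \<le> (hnorm H x)\<^sup>2 - 2 * \<rho> * (c * (hnorm H x)\<^sup>2) + \<rho>\<^sup>2 * (L * hnorm H x)\<^sup>2"
    proof -
      have "2 * \<rho> * (c * (hnorm H x)\<^sup>2) \<le> 2 * \<rho> * Re (ip H (T x) x)"
        using below[OF x] c L by (intro mult_left_mono) (auto simp: \<rho>_def)
      moreover have "\<rho>\<^sup>2 * (hnorm H (T x))\<^sup>2 \<le> \<rho>\<^sup>2 * (L * hnorm H x)\<^sup>2"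
        using L(3)[OF x] x TV by (intro mult_left_mono power_mono) auto
      ultimately show ?thesis by linarith
    qed
    also have "\<dots> = q * (hnorm H x)\<^sup>2"
      using L(1) by (simp add: q_def \<rho>_def field_simps power2_eq_square)
    also have "\<dots> = (sqrt q * hnorm H x)\<^sup>2"
      using q by (simp add: power_mult_distrib)
    finally show ?thesis
      by (rule power2_le_imp_le) (use q x in simp)
  qed
  have bound_inv: "c * hnorm H x \<le> hnorm H (T x)" if x: "x \<in> vecs H" for x
  proof (cases "x = 0")
    case False
    have "c * (hnorm H x)\<^sup>2 \<le> hnorm H (T x) * hnorm H x"
      using below[OF x] Cauchy_Schwarz[OF TV[OF x] x] complex_Re_le_cmod[of "ip H (T x) x"]
      by linarith
    then show ?thesis
      using hnorm_pos[OF x False] by (simp add: power2_eq_square)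
  qed (use x TV in simp)
  have surj: "\<exists>x\<in>vecs H. T x = y" if y: "y \<in> vecs H" for y
  proof -
    define s where "s = rec_nat 0 (\<lambda>_ x. E x + scl H (of_real \<rho>) y)"
    have s0: "s 0 = 0" and sS: "s (Suc i) = E (s i) + scl H (of_real \<rho>) y" for i
      by (auto simp: s_def)
    have sV: "s i \<in> vecs H" for i
      by (induction i) (auto simp: s0 sS EV y)
    have step: "hnorm H (s (Suc i) - s i) \<le> sqrt q ^ i * hnorm H (s (Suc 0) - s 0)" for i
    proof (induction i)
      case (Suc i)
      have "s (Suc (Suc i)) - s (Suc i) = E (s (Suc i) - s i)"
        using Ediff[OF sV sV, of "Suc i" i] by (simp add: sS[of "Suc i"] sS[of i])
      then have "hnorm H (s (Suc (Suc i)) - s (Suc i)) \<le> sqrt q * hnorm H (s (Suc i) - s i)"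
        using contract[of "s (Suc i) - s i"] sV by simp
      also have "\<dots> \<le> sqrt q * (sqrt q ^ i * hnorm H (s (Suc 0) - s 0))"
        using Suc q by (intro mult_left_mono) auto
      finally show ?case by simp
    qed simp
    have rq: "0 \<le> sqrt q" "sqrt q < 1" using q by auto
    obtain l where l: "l \<in> vecs H" "(\<lambda>i. hnorm H (s i - l)) \<longlonglongrightarrow> 0"
      by (rule geometric_steps_converge[OF sV step rq])
    have fixpoint: "l = E l + scl H (of_real \<rho>) y"
    proof (rule eq_if_hnorm_small)
      fix e :: real assume "0 < e"
      then obtain N where N: "\<And>i. i \<ge> N \<Longrightarrow> hnorm H (s i - l) < e / 2"
        using order_tendstoD(2)[OF l(2), of "e / 2"] by (auto simp: eventually_sequentially)
      have "hnorm H (s (Suc N) - (E l + scl H (of_real \<rho>) y)) \<le> hnorm H (s N - l)"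
      proof -
        have "s (Suc N) - (E l + scl H (of_real \<rho>) y) = E (s N - l)"
          using Ediff[OF sV l(1), of N] by (simp add: sS)
        moreover have "sqrt q * hnorm H (s N - l) \<le> 1 * hnorm H (s N - l)"
          using rq sV l by (intro mult_right_mono) auto
        ultimately show ?thesis
          using contract[of "s N - l"] sV l by simp
      qed
      then show "hnorm H (l - (E l + scl H (of_real \<rho>) y)) \<le> e"
        using N[of N] N[of "Suc N"] hnorm_diff_commute[of l "s (Suc N)"]
          hnorm_triangle_diff[of l "s (Suc N)" "E l + scl H (of_real \<rho>) y"] l y sV EV
        by simp
    qed (use l y EV in auto)
    have "scl H (of_real \<rho>) (T l) = scl H (of_real \<rho>) y"
      using fixpoint by (simp add: E_def algebra_simps)
    moreover have "\<rho> \<noteq> 0" using c L(1) by (simp add: \<rho>_def)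
    ultimately have "T l = y"
      by (metis of_real_eq_0_iff scaling.scale_left_imp_eq)
    then show ?thesis using l by blast
  qed
  have inj: "x = y" if "x \<in> vecs H" "y \<in> vecs H" "T x = T y" for x y
  proof -
    have "hnorm H (x - y) \<le> 0"
      using bound_inv[of "x - y"] that c by (simp add: bounded_op_diff[OF bd] mult_le_0_iff)
    then show ?thesis
      using hnorm_pos[of "x - y"] that by fastforce
  qed
  define S where "S = (\<lambda>y. SOME x. x \<in> vecs H \<and> T x = y)"
  have S: "S y \<in> vecs H \<and> T (S y) = y" if "y \<in> vecs H" for y
    unfolding S_def by (rule someI_ex) (use surj[OF that] in blast)
  have "bounded_op H S"
  proof (rule bounded_opI[where b = "1 / c"])
    fix x y assume xy: "x \<in> vecs H" "y \<in> vecs H"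
    show "S (x + y) = S x + S y"
      by (rule inj) (use xy S in \<open>auto simp: bounded_op_add[OF bd]\<close>)
  next
    fix z x assume x: "x \<in> vecs H"
    show "S (scl H z x) = scl H z (S x)"
      by (rule inj) (use x S in \<open>auto simp: bounded_op_scl[OF bd]\<close>)
  next
    fix x assume x: "x \<in> vecs H"
    show "hnorm H (S x) \<le> 1 / c * hnorm H x"
      using bound_inv[of "S x"] S[OF x] c by (simp add: field_simps)
  qed (use S in auto)
  moreover have "\<forall>x\<in>vecs H. T (S x) = x \<and> S (T x) = x"
    using S TV inj by blast
  ultimately show ?thesis
    using bd unfolding invertible_op_def by blast
qed

text \<open>
  Cauchy-Schwarz for the form of \<open>T\<close> bounds \<open>\<parallel>T x\<parallel>\<^sup>2\<close> by a multiple of the form, while the inverse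
  bounds \<open>\<parallel>x\<parallel>\<close> by \<open>\<parallel>T x\<parallel>\<close>.
\<close>

lemma positive_invertible_bounded_below:
  assumes T: "positive_op H T" and inv: "invertible_op H T"
  obtains d where "0 < d" "\<And>x. x \<in> vecs H \<Longrightarrow> d * (hnorm H x)\<^sup>2 \<le> Re (ip H (T x) x)"
proof -
  have bd: "bounded_op H T"
    using T by (simp add: positive_op_def selfadjoint_op_def)
  obtain K where K: "0 < K" "\<And>x. x \<in> vecs H \<Longrightarrow> hnorm H (T x) \<le> K * hnorm H x"
    using bounded_op_bound[OF bd] by blast
  obtain S where S: "bounded_op H S" "\<And>x. x \<in> vecs H \<Longrightarrow> S (T x) = x"
    using inv unfolding invertible_op_def by blast
  obtain b where b: "0 < b" "\<And>x. x \<in> vecs H \<Longrightarrow> hnorm H (S x) \<le> b * hnorm H x"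
    using bounded_op_bound[OF S(1)] by blast
  have "1 / (b\<^sup>2 * K) * (hnorm H x)\<^sup>2 \<le> Re (ip H (T x) x)" if x: "x \<in> vecs H" for x
  proof -
    have Tx: "T x \<in> vecs H" using bd x by (rule bounded_op_vecs)
    have form: "(hnorm H (T x))\<^sup>2 \<le> K * Re (ip H (T x) x)"
    proof (cases "T x = 0")
      case False
      have "((hnorm H (T x))\<^sup>2)\<^sup>2 \<le> (cmod (ip H (T x) (T x)))\<^sup>2"
        using Tx complex_Re_le_cmod[of "ip H (T x) (T x)"]
        by (intro power_mono) (auto simp: hnorm_square ip_self_nonneg)
      also have "\<dots> \<le> Re (ip H (T x) x) * Re (ip H (T (T x)) (T x))"
        by (rule positive_Cauchy_Schwarz[OF T x Tx])
      also have "\<dots> \<le> Re (ip H (T x) x) * (K * (hnorm H (T x))\<^sup>2)"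
      proof (rule mult_left_mono)
        have "Re (ip H (T (T x)) (T x)) \<le> hnorm H (T (T x)) * hnorm H (T x)"
          using Cauchy_Schwarz[of "T (T x)" "T x"] complex_Re_le_cmod[of "ip H (T (T x)) (T x)"] Tx
            bounded_op_vecs[OF bd Tx] by linarith
        also have "\<dots> \<le> K * hnorm H (T x) * hnorm H (T x)"
          using K(2)[OF Tx] Tx by (intro mult_right_mono) auto
        finally show "Re (ip H (T (T x)) (T x)) \<le> K * (hnorm H (T x))\<^sup>2"
          by (simp add: power2_eq_square)
      qed (use T x in \<open>auto simp: positive_op_def\<close>)
      finally have "(hnorm H (T x))\<^sup>2 * (hnorm H (T x))\<^sup>2 \<le> (K * Re (ip H (T x) x)) * (hnorm H (T x))\<^sup>2"
        by (simp add: power2_eq_square mult_ac)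
      then show ?thesis
        by (rule mult_right_le_imp_le) (use hnorm_pos[OF Tx False] in simp)
    qed (use x K T in \<open>auto simp: positive_op_def\<close>)
    have "(hnorm H x)\<^sup>2 \<le> (b * hnorm H (T x))\<^sup>2"
      using b(2)[OF Tx] S(2)[OF x] x by (intro power_mono) auto
    also have "\<dots> \<le> b\<^sup>2 * (K * Re (ip H (T x) x))"
      unfolding power_mult_distrib using form by (intro mult_left_mono) auto
    finally show ?thesis
      using b(1) K(1) by (simp add: field_simps)
  qed
  then show ?thesis
    by (rule that[rotated]) (use b K in auto)
qed

lemma quad_bounded:
  assumes T: "selfadjoint_op H T"
  obtains K where "0 < K" "\<And>x. x \<in> vecs H \<Longrightarrow> \<bar>Re (ip H (T x) x)\<bar> \<le> K * (hnorm H x)\<^sup>2"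
proof -
  obtain K where K: "0 < K" "\<And>x. x \<in> vecs H \<Longrightarrow> hnorm H (T x) \<le> K * hnorm H x"
    using bounded_op_bound[OF selfadjoint_opD(1)[OF T]] by blast
  have "\<bar>Re (ip H (T x) x)\<bar> \<le> K * (hnorm H x)\<^sup>2" if x: "x \<in> vecs H" for x
  proof -
    have "\<bar>Re (ip H (T x) x)\<bar> \<le> hnorm H (T x) * hnorm H x"
      using Cauchy_Schwarz[of "T x" x] abs_Re_le_cmod[of "ip H (T x) x"] x
        selfadjoint_op_vecs[OF T x] by linarith
    also have "\<dots> \<le> K * hnorm H x * hnorm H x"
      using K(2)[OF x] x by (intro mult_right_mono) auto
    finally show ?thesis by (simp add: power2_eq_square mult_ac)
  qed
  then show ?thesis
    using that K(1) by blast
qed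

lemma selfadjoint_op_shift:
  "selfadjoint_op H T \<Longrightarrow> selfadjoint_op H (\<lambda>x. T x - scl H (of_real r) x)"
  by (rule selfadjoint_op_cong[OF selfadjoint_op_minus[OF _ selfadjoint_op_op_scale[OF selfadjoint_op_id]]])
    (auto simp: op_scale_def)

lemma quad_shift:
  "selfadjoint_op H T \<Longrightarrow> x \<in> vecs H \<Longrightarrow>
    Re (ip H (T x - scl H (of_real r) x) x) = Re (ip H (T x) x) - r * (hnorm H x)\<^sup>2"
  by (simp add: ip_simps selfadjoint_op_vecs hnorm_square)

text \<open>
  The infimum of the quadratic form over the unit sphere is a spectral value: the shifted operator
  is positive, so by \<open>positive_invertible_bounded_below\<close> invertibility would push the infimum up.
\<close>

lemma spectral_minimum:
  assumes T: "selfadjoint_op H T" and v: "v \<in> vecs H" "v \<noteq> 0"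
  obtains r where "of_real r \<in> op_spectrum H T"
    "\<And>x. x \<in> vecs H \<Longrightarrow> r * (hnorm H x)\<^sup>2 \<le> Re (ip H (T x) x)"
proof -
  define R where "R = (\<lambda>x. Re (ip H (T x) x) / (hnorm H x)\<^sup>2) ` (vecs H - {0})"
  obtain K where K: "\<And>x. x \<in> vecs H \<Longrightarrow> \<bar>Re (ip H (T x) x)\<bar> \<le> K * (hnorm H x)\<^sup>2"
    using quad_bounded[OF T] by blast
  have "R \<noteq> {}" using v by (auto simp: R_def)
  have "bdd_below R"
  proof (rule bdd_belowI[of _ "- K"])
    fix t assume "t \<in> R"
    then obtain x where x: "x \<in> vecs H" "x \<noteq> 0" "t = Re (ip H (T x) x) / (hnorm H x)\<^sup>2"
      by (auto simp: R_def)
    have "0 < (hnorm H x)\<^sup>2"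
      using hnorm_pos[OF x(1,2)] by simp
    then have "t * (hnorm H x)\<^sup>2 = Re (ip H (T x) x)"
      using x(3) by simp
    then have "- K * (hnorm H x)\<^sup>2 \<le> t * (hnorm H x)\<^sup>2"
      using K[OF x(1)] by linarith
    then show "- K \<le> t"
      using \<open>0 < (hnorm H x)\<^sup>2\<close> by (rule mult_right_le_imp_le)
  qed
  define r where "r = Inf R"
  have below: "r * (hnorm H x)\<^sup>2 \<le> Re (ip H (T x) x)" if x: "x \<in> vecs H" for x
  proof (cases "x = 0")
    case False
    have "r \<le> Re (ip H (T x) x) / (hnorm H x)\<^sup>2"
      unfolding r_def by (rule cInf_lower) (use x False \<open>bdd_below R\<close> in \<open>auto simp: R_def\<close>)
    then show ?thesis
      using hnorm_pos[OF x False] by (simp add: field_simps)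
  qed (use selfadjoint_op_vecs[OF T x] x in simp)
  let ?D = "\<lambda>x. T x - scl H (of_real r) x"
  have "\<not> invertible_op H ?D"
  proof
    assume inv: "invertible_op H ?D"
    have "positive_op H ?D"
      using selfadjoint_op_shift[OF T] below by (simp add: positive_op_def quad_shift T)
    then obtain d where d: "0 < d" "\<And>x. x \<in> vecs H \<Longrightarrow> d * (hnorm H x)\<^sup>2 \<le> Re (ip H (?D x) x)"
      using positive_invertible_bounded_below[OF _ inv] by blast
    have "r + d \<le> Inf R"
    proof (rule cInf_greatest[OF \<open>R \<noteq> {}\<close>])
      fix t assume "t \<in> R"
      then obtain x where x: "x \<in> vecs H" "x \<noteq> 0" "t = Re (ip H (T x) x) / (hnorm H x)\<^sup>2"
        by (auto simp: R_def)
      have pos: "0 < (hnorm H x)\<^sup>2"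
        using hnorm_pos[OF x(1,2)] by simp
      then have "(r + d) * (hnorm H x)\<^sup>2 \<le> t * (hnorm H x)\<^sup>2"
        using d(2)[OF x(1)] x by (simp add: quad_shift T algebra_simps)
      then show "r + d \<le> t"
        using pos by (rule mult_right_le_imp_le)
    qed
    then show False using d(1) by (simp add: r_def)
  qed
  then show ?thesis
    using that below by (auto simp: op_spectrum_def)
qed

text \<open>
  The order relation \<open>a \<le> X \<le> b\<close>, stated through the quadratic form so that it can be verified vector
  by vector. It is how spectral information enters: it confines the spectrum to \<open>[a, b]\<close>.
\<close>

definition form_range :: "('a \<Rightarrow> 'a) \<Rightarrow> real \<Rightarrow> real \<Rightarrow> bool" where
  "form_range X a b \<longleftrightarrow> selfadjoint_op H X \<and>
    (\<forall>x\<in>vecs H. a * (hnorm H x)\<^sup>2 \<le> Re (ip H (X x) x) \<and> Re (ip H (X x) x) \<le> b * (hnorm H x)\<^sup>2)"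

lemma form_range_selfadjoint: "form_range X a b \<Longrightarrow> selfadjoint_op H X"
  by (simp add: form_range_def)

lemma spectrum_in_form_range:
  assumes X: "form_range X a b" and t: "of_real t \<in> op_spectrum H X"
  shows "t \<in> {a..b}"
proof (rule ccontr)
  assume "t \<notin> {a..b}"
  then consider "t < a" | "b < t" by fastforce
  then have "invertible_op H (\<lambda>x. X x - scl H (of_real t) x)"
  proof cases
    case 1
    show ?thesis
    proof (rule bounded_below_invertible[of _ "a - t"])
      fix x assume "x \<in> vecs H"
      then show "(a - t) * (hnorm H x)\<^sup>2 \<le> Re (ip H (X x - scl H (of_real t) x) x)"
        using X by (simp add: form_range_def quad_shift algebra_simps)
    qed (use 1 X in \<open>auto intro: selfadjoint_op_shift simp: form_range_def\<close>)
  next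
    case 2
    let ?N = "op_scale H (-1) (\<lambda>x. X x - scl H (of_real t) x)"
    have sa: "selfadjoint_op H (\<lambda>x. X x - scl H (of_real t) x)"
      using X by (auto intro: selfadjoint_op_shift simp: form_range_def)
    have "invertible_op H ?N"
    proof (rule bounded_below_invertible[of _ "t - b"])
      fix x assume "x \<in> vecs H"
      then show "(t - b) * (hnorm H x)\<^sup>2 \<le> Re (ip H (?N x) x)"
        using X sa by (simp add: form_range_def quad_shift quad_op_scale algebra_simps)
    qed (use 2 sa in \<open>auto intro: selfadjoint_op_op_scale\<close>)
    moreover have "invertible_op H (op_scale H (-1) id)"
      unfolding invertible_op_def
      by (intro conjI exI[of _ "op_scale H (-1) id"] bounded_op_op_scale bounded_op_id)
        (simp add: op_scale_def)
    ultimately have "invertible_op H (op_scale H (-1) id \<circ> ?N)"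
      by (intro invertible_op_comp)
    then show ?thesis
      by (rule invertible_op_cong) (simp add: op_scale_def)
  qed
  then show False using t by (simp add: op_spectrum_def)
qed

section \<open>Polynomials of a self-adjoint operator\<close>

lemma selfadjoint_op_funpow: "selfadjoint_op H X \<Longrightarrow> selfadjoint_op H (X ^^ i)"
  by (induction i) (auto intro!: selfadjoint_op_comp selfadjoint_op_id simp: funpow_swap1
      simp flip: id_def)

lemma selfadjoint_op_poly_op: "selfadjoint_op H X \<Longrightarrow> selfadjoint_op H (poly_op H p X)"
  unfolding poly_op_def
  by (intro selfadjoint_op_sum selfadjoint_op_op_scale selfadjoint_op_funpow)

lemma poly_op_vecs: "selfadjoint_op H X \<Longrightarrow> x \<in> vecs H \<Longrightarrow> poly_op H p X x \<in> vecs H"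
  by (rule selfadjoint_op_vecs[OF selfadjoint_op_poly_op])

lemma bounded_op_sum_arg:
  assumes X: "bounded_op H X" and g: "\<And>i. i \<in> I \<Longrightarrow> g i \<in> vecs H"
  shows "X (\<Sum>i\<in>I. g i) = (\<Sum>i\<in>I. X (g i))"
proof -
  have "X 0 = 0" using bounded_op_diff[OF X, of 0 0] by simp
  then show ?thesis
    using g by (induction I rule: infinite_finite_induct) (auto simp: bounded_op_add[OF X] vecs_sum)
qed

lemma poly_op_0 [simp]: "poly_op H 0 X x = 0"
  by (simp add: poly_op_def op_scale_def)

lemma poly_op_pCons:
  assumes X: "selfadjoint_op H X" and x: "x \<in> vecs H"
  shows "poly_op H (pCons a p) X x = scl H (of_real a) x + X (poly_op H p X x)"
proof -
  have expand: "poly_op H q X x = (\<Sum>i\<le>n. scl H (of_real (coeff q i)) ((X ^^ i) x))"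
    if "degree q \<le> n" for q n
  proof -
    have "(\<Sum>i\<le>degree q. scl H (of_real (coeff q i)) ((X ^^ i) x)) =
        (\<Sum>i\<le>n. scl H (of_real (coeff q i)) ((X ^^ i) x))"
      by (rule sum.mono_neutral_left) (use that in \<open>auto simp: coeff_eq_0\<close>)
    then show ?thesis
      by (simp add: poly_op_def op_scale_def sum_fun_apply)
  qed
  have pow: "(X ^^ i) x \<in> vecs H" for i
    using selfadjoint_op_vecs[OF selfadjoint_op_funpow[OF X] x] .
  have bd: "bounded_op H X" using X by (rule selfadjoint_opD)
  have "poly_op H (pCons a p) X x =
      (\<Sum>i\<le>Suc (degree p). scl H (of_real (coeff (pCons a p) i)) ((X ^^ i) x))"
    by (rule expand) (rule degree_pCons_le)
  also have "\<dots> = scl H (of_real a) x +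
      (\<Sum>i\<le>degree p. scl H (of_real (coeff p i)) (X ((X ^^ i) x)))"
    by (simp only: sum.atMost_Suc_shift coeff_pCons_0 coeff_pCons_Suc funpow.simps o_apply id_apply)
  also have "(\<Sum>i\<le>degree p. scl H (of_real (coeff p i)) (X ((X ^^ i) x))) = X (poly_op H p X x)"
    unfolding expand[OF order_refl]
    by (subst bounded_op_sum_arg[OF bd]) (auto simp: pow bounded_op_scl[OF bd])
  finally show ?thesis .
qed

lemma poly_op_const:
  "selfadjoint_op H X \<Longrightarrow> x \<in> vecs H \<Longrightarrow> poly_op H [:a:] X x = scl H (of_real a) x"
  using bounded_op_diff[of X 0 0] by (simp add: poly_op_pCons selfadjoint_opD(1))

lemma poly_op_linear:
  "selfadjoint_op H X \<Longrightarrow> x \<in> vecs H \<Longrightarrow> poly_op H [:a, 1:] X x = scl H (of_real a) x + X x"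
  by (subst poly_op_pCons) (simp_all add: poly_op_const)

lemma poly_op_add:
  assumes X: "selfadjoint_op H X" and x: "x \<in> vecs H"
  shows "poly_op H (p + q) X x = poly_op H p X x + poly_op H q X x"
proof (induction p q rule: poly_induct2)
  case (pCons a p b q)
  then show ?case
    by (simp add: poly_op_pCons[OF X x] bounded_op_add[OF selfadjoint_opD(1)[OF X]]
        poly_op_vecs[OF X x] scaling.scale_left_distrib)
qed simp

lemma poly_op_smult:
  assumes X: "selfadjoint_op H X" and x: "x \<in> vecs H"
  shows "poly_op H (smult c p) X x = scl H (of_real c) (poly_op H p X x)"
proof (induction p)
  case (pCons a p)
  then show ?case
    by (simp add: poly_op_pCons[OF X x] bounded_op_scl[OF selfadjoint_opD(1)[OF X]]
        poly_op_vecs[OF X x] scaling.scale_right_distrib)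
qed simp

lemma poly_op_diff:
  assumes X: "selfadjoint_op H X" and x: "x \<in> vecs H"
  shows "poly_op H (p - q) X x = poly_op H p X x - poly_op H q X x"
  using poly_op_add[OF X x, of p "smult (-1) q"] poly_op_smult[OF X x, of "-1" q] by simp

lemma poly_op_mult:
  assumes X: "selfadjoint_op H X" and x: "x \<in> vecs H"
  shows "poly_op H (p * q) X x = poly_op H p X (poly_op H q X x)"
proof (induction p)
  case (pCons a p)
  have "poly_op H (pCons a p * q) X x =
      scl H (of_real a) (poly_op H q X x) + X (poly_op H p X (poly_op H q X x))"
    using pCons by (simp add: poly_op_add[OF X x] poly_op_smult[OF X x] poly_op_pCons[OF X x])
  then show ?case
    by (simp add: poly_op_pCons[OF X poly_op_vecs[OF X x]])
qed simp

text \<open>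
  The half of the spectral mapping theorem that is needed. Since invertibility is inherited by
  products, some irreducible factor must fail to be invertible, and a definite quadratic
  \<open>(X - a)\<^sup>2 + b\<^sup>2\<close> never does. The factor that fails is thus linear, and its root is real.
\<close>

lemma poly_op_singular_root:
  assumes X: "selfadjoint_op H X" and "q \<noteq> 0" and "\<not> invertible_op H (poly_op H q X)"
  shows "\<exists>t. of_real t \<in> op_spectrum H X \<and> poly q t = 0"
  using assms(2,3)
proof (induction "degree q" arbitrary: q rule: less_induct)
  case less
  have factor: "\<exists>t. of_real t \<in> op_spectrum H X \<and> poly q t = 0"
    if d: "0 < degree d" "invertible_op H (poly_op H d X)" and q: "q = d * k" for d k
  proof -
    have "d \<noteq> 0" "k \<noteq> 0" using less.prems(1) q by auto
    then have "degree k < degree q" using d(1) q by (simp add: degree_mult_eq)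
    moreover have "\<not> invertible_op H (poly_op H k X)"
    proof
      assume "invertible_op H (poly_op H k X)"
      then have "invertible_op H (poly_op H d X \<circ> poly_op H k X)"
        using d(2) by (intro invertible_op_comp)
      then have "invertible_op H (poly_op H q X)"
        by (rule invertible_op_cong) (simp add: q poly_op_mult[OF X])
      then show False using less.prems(2) by simp
    qed
    ultimately obtain t where "of_real t \<in> op_spectrum H X" "poly k t = 0"
      using less.hyps[of k] \<open>k \<noteq> 0\<close> by blast
    then show ?thesis by (auto simp: q)
  qed
  show ?case
  proof (cases "degree q = 0")
    case True
    then obtain c where c: "q = [:c:]" by (auto elim: degree_eq_zeroE)
    then have "c \<noteq> 0" using less.prems(1) by simp
    then have "invertible_op H (poly_op H q X)"
      unfolding invertible_op_def
      by (intro conjI exI[of _ "poly_op H [:1 / c:] X"] selfadjoint_opD(1) selfadjoint_op_poly_op X)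
        (auto simp: c poly_op_const[OF X] simp flip: of_real_mult)
    then show ?thesis using less.prems(2) by simp
  next
    case False
    then have "0 < degree q" by simp
    then show ?thesis
    proof (cases rule: real_poly_factor)
      case (1 a k)
      show ?thesis
      proof (cases "invertible_op H (poly_op H [:- a, 1:] X)")
        case True
        then show ?thesis using 1 by (intro factor[of "[:- a, 1:]" k]) auto
      next
        case False
        have "of_real a \<in> op_spectrum H X"
        proof (rule ccontr)
          assume "of_real a \<notin> op_spectrum H X"
          then have "invertible_op H (\<lambda>x. X x - scl H (of_real a) x)"
            by (simp add: op_spectrum_def)
          then have "invertible_op H (poly_op H [:- a, 1:] X)"
            by (rule invertible_op_cong) (simp add: poly_op_linear[OF X])
          then show False using False by simp
        qed
        moreover have "poly q a = 0" using 1 by simp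
        ultimately show ?thesis by blast
      qed
    next
      case (2 a b k)
      let ?l = "[:- a, 1:]"
      let ?d = "?l * ?l + [:b\<^sup>2:]"
      have "invertible_op H (poly_op H ?d X)"
      proof (rule bounded_below_invertible[of _ "b\<^sup>2"])
        fix x assume x: "x \<in> vecs H"
        let ?y = "poly_op H ?l X x"
        have y: "?y \<in> vecs H" using poly_op_vecs[OF X x] .
        have "poly_op H ?d X x = poly_op H ?l X ?y + scl H (of_real (b\<^sup>2)) x"
          by (simp only: poly_op_add[OF X x] poly_op_mult[OF X x] poly_op_const[OF X x])
        then have "Re (ip H (poly_op H ?d X x) x) =
            Re (ip H (poly_op H ?l X ?y) x) + b\<^sup>2 * (hnorm H x)\<^sup>2"
          using x y by (simp add: ip_simps poly_op_vecs[OF X] hnorm_square del: of_real_power)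
        also have "ip H (poly_op H ?l X ?y) x = ip H ?y ?y"
          using selfadjoint_opD(2)[OF selfadjoint_op_poly_op[OF X] y x] .
        finally show "b\<^sup>2 * (hnorm H x)\<^sup>2 \<le> Re (ip H (poly_op H ?d X x) x)"
          using ip_self_nonneg[OF y] by simp
      qed (use 2 X in \<open>auto intro: selfadjoint_op_poly_op\<close>)
      then show ?thesis
        using 2 by (intro factor[of ?d k]) auto
    qed
  qed
qed

text \<open>
  The minimum \<open>r\<close> of the form of \<open>p(X)\<close> lies in the spectrum of \<open>p(X)\<close>, so \<open>p - r\<close> vanishes at
  some point of the spectrum of \<open>X\<close>, where \<open>p\<close> is nonnegative by assumption.
\<close>

lemma poly_op_nonneg:
  assumes X: "selfadjoint_op H X"
    and p: "\<And>t. of_real t \<in> op_spectrum H X \<Longrightarrow> 0 \<le> poly p t" and x: "x \<in> vecs H"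
  shows "0 \<le> Re (ip H (poly_op H p X x) x)"
proof (cases "x = 0")
  case True
  then show ?thesis using poly_op_vecs[OF X x] by simp
next
  case False
  obtain r where r: "of_real r \<in> op_spectrum H (poly_op H p X)"
    "\<And>x. x \<in> vecs H \<Longrightarrow> r * (hnorm H x)\<^sup>2 \<le> Re (ip H (poly_op H p X x) x)"
    using spectral_minimum[OF selfadjoint_op_poly_op[OF X] x False] by blast
  have "\<exists>t. of_real t \<in> op_spectrum H X \<and> poly (p - [:r:]) t = 0"
  proof (cases "p = [:r:]")
    case True
    then show ?thesis
      using spectral_minimum[OF X x False] by auto
  next
    case False
    have "\<not> invertible_op H (poly_op H (p - [:r:]) X)"
    proof
      assume "invertible_op H (poly_op H (p - [:r:]) X)"
      then have "invertible_op H (\<lambda>x. poly_op H p X x - scl H (of_real r) x)"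
        by (rule invertible_op_cong) (simp add: poly_op_diff[OF X] poly_op_const[OF X])
      then show False using r(1) by (simp add: op_spectrum_def)
    qed
    then show ?thesis
      using False by (intro poly_op_singular_root[OF X]) auto
  qed
  then obtain t where t: "of_real t \<in> op_spectrum H X" "poly p t = r" by auto
  then have "0 \<le> r" using p by blast
  then have "0 \<le> r * (hnorm H x)\<^sup>2" by simp
  then show ?thesis using r(2)[OF x] by linarith
qed

text \<open>Positivity of \<open>e\<^sup>2 - p(X)\<^sup>2\<close> is the norm bound, since \<open>p(X)\<close> is self-adjoint.\<close>

lemma poly_op_norm_le:
  assumes X: "selfadjoint_op H X" and e: "0 \<le> e"
    and p: "\<And>t. of_real t \<in> op_spectrum H X \<Longrightarrow> \<bar>poly p t\<bar> \<le> e" and x: "x \<in> vecs H"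
  shows "hnorm H (poly_op H p X x) \<le> e * hnorm H x"
proof (rule power2_le_imp_le)
  let ?y = "poly_op H p X x"
  have y: "?y \<in> vecs H" using poly_op_vecs[OF X x] .
  have "0 \<le> Re (ip H (poly_op H ([:e\<^sup>2:] - p * p) X x) x)"
  proof (rule poly_op_nonneg[OF X _ x])
    fix t assume "of_real t \<in> op_spectrum H X"
    then have "(poly p t)\<^sup>2 \<le> e\<^sup>2" using p[of t] e by (intro abs_le_square_iff[THEN iffD1]) simp
    then show "0 \<le> poly ([:e\<^sup>2:] - p * p) t" by (simp add: power2_eq_square)
  qed
  also have "poly_op H ([:e\<^sup>2:] - p * p) X x = scl H (of_real (e\<^sup>2)) x - poly_op H p X ?y"
    by (simp only: poly_op_diff[OF X x] poly_op_const[OF X x] poly_op_mult[OF X x])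
  also have "Re (ip H \<dots> x) = e\<^sup>2 * (hnorm H x)\<^sup>2 - Re (ip H (poly_op H p X ?y) x)"
    using x y by (simp add: ip_simps poly_op_vecs[OF X] hnorm_square del: of_real_power)
  also have "ip H (poly_op H p X ?y) x = ip H ?y ?y"
    using selfadjoint_opD(2)[OF selfadjoint_op_poly_op[OF X] y x] .
  finally show "(hnorm H ?y)\<^sup>2 \<le> (e * hnorm H x)\<^sup>2"
    using y by (simp add: hnorm_square power_mult_distrib)
qed (use e x in simp)

section \<open>Continuous functional calculus\<close>

text \<open>
  All properties of \<open>f(X)\<close> are obtained from a single polynomial that is close to \<open>f\<close> on the
  spectrum and whose value at \<open>X\<close> is equally close to \<open>f(X)\<close> in norm.
\<close>

definition poly_approx :: "(real \<Rightarrow> real) \<Rightarrow> ('a \<Rightarrow> 'a) \<Rightarrow> ('a \<Rightarrow> 'a) \<Rightarrow> real \<Rightarrow> real poly \<Rightarrow> bool" where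
  "poly_approx f X Y e p \<longleftrightarrow>
    (\<forall>t. of_real t \<in> op_spectrum H X \<longrightarrow> \<bar>poly p t - f t\<bar> \<le> e) \<and>
    (\<forall>x\<in>vecs H. hnorm H (poly_op H p X x - Y x) \<le> e * hnorm H x)"

lemma is_fun_calc_iff:
  "is_fun_calc H f X Y \<longleftrightarrow> bounded_op H Y \<and> (\<forall>x. x \<notin> vecs H \<longrightarrow> Y x = 0) \<and>
    (\<forall>e>0. \<exists>p. poly_approx f X Y e p)"
proof
  assume Y: "is_fun_calc H f X Y"
  then obtain P where P:
    "uniform_limit {t. complex_of_real t \<in> op_spectrum H X} (\<lambda>k. poly (P k)) f sequentially"
    "\<And>e. 0 < e \<Longrightarrow> \<forall>\<^sub>F k in sequentially. \<forall>x\<in>vecs H.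
        hnorm H (poly_op H (P k) X x - Y x) \<le> e * hnorm H x"
    by (auto simp: is_fun_calc_def)
  have "\<exists>p. poly_approx f X Y e p" if "0 < e" for e
  proof -
    have "\<forall>\<^sub>F k in sequentially. poly_approx f X Y e (P k)"
      using uniform_limitD[OF P(1) that] P(2)[OF that]
      by eventually_elim (auto simp: poly_approx_def dist_real_def less_imp_le)
    then show ?thesis
      using eventually_happens'[OF sequentially_bot] by blast
  qed
  then show "bounded_op H Y \<and> (\<forall>x. x \<notin> vecs H \<longrightarrow> Y x = 0) \<and> (\<forall>e>0. \<exists>p. poly_approx f X Y e p)"
    using Y by (simp add: is_fun_calc_def)
next
  assume Y: "bounded_op H Y \<and> (\<forall>x. x \<notin> vecs H \<longrightarrow> Y x = 0) \<and> (\<forall>e>0. \<exists>p. poly_approx f X Y e p)"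
  then have "\<forall>k. \<exists>p. poly_approx f X Y (inverse (real (Suc k))) p"
    by simp
  then obtain P where P: "\<And>k. poly_approx f X Y (inverse (real (Suc k))) (P k)"
    by metis
  have small: "\<forall>\<^sub>F k in sequentially. inverse (real (Suc k)) < e" if "0 < e" for e
    using order_tendstoD(2)[OF LIMSEQ_inverse_real_of_nat that] .
  have "uniform_limit {t. complex_of_real t \<in> op_spectrum H X} (\<lambda>k. poly (P k)) f sequentially"
  proof (rule uniform_limitI)
    fix e :: real assume "0 < e"
    from small[OF this]
    show "\<forall>\<^sub>F k in sequentially. \<forall>t\<in>{t. complex_of_real t \<in> op_spectrum H X}.
        dist (poly (P k) t) (f t) < e"
    proof eventually_elim
      case (elim k)
      then show ?case
        using P[of k] by (auto simp: poly_approx_def dist_real_def intro: le_less_trans)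
    qed
  qed
  moreover have "\<forall>\<^sub>F k in sequentially. \<forall>x\<in>vecs H.
      hnorm H (poly_op H (P k) X x - Y x) \<le> e * hnorm H x" if "0 < e" for e
    using small[OF that]
  proof eventually_elim
    case (elim k)
    have "inverse (real (Suc k)) * hnorm H x \<le> e * hnorm H x" if "x \<in> vecs H" for x
      using elim that by (intro mult_right_mono) auto
    then show ?case
      using P[of k] unfolding poly_approx_def by (meson order_trans)
  qed
  ultimately show "is_fun_calc H f X Y"
    using Y unfolding is_fun_calc_def by blast
qed

lemma poly_approxD:
  assumes "poly_approx f X Y e p"
  shows "\<And>t. of_real t \<in> op_spectrum H X \<Longrightarrow> \<bar>poly p t - f t\<bar> \<le> e"
    and "\<And>x. x \<in> vecs H \<Longrightarrow> hnorm H (poly_op H p X x - Y x) \<le> e * hnorm H x"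
  using assms by (auto simp: poly_approx_def)

lemma is_fun_calc_approx:
  assumes "is_fun_calc H f X Y" "0 < e"
  obtains p where "poly_approx f X Y e p"
  using assms by (auto simp: is_fun_calc_iff)

lemma is_fun_calc_bounded: "is_fun_calc H f X Y \<Longrightarrow> bounded_op H Y"
  by (simp add: is_fun_calc_def)

lemma is_fun_calc_cong:
  assumes "is_fun_calc H f X Y" "\<And>t. of_real t \<in> op_spectrum H X \<Longrightarrow> g t = f t"
  shows "is_fun_calc H g X Y"
  using assms by (simp add: is_fun_calc_iff poly_approx_def)

text \<open>
  Approximants of two candidates are close to each other on the spectrum, and
  \<open>poly_op_norm_le\<close> carries this over to their values at \<open>X\<close>.
\<close>

lemma is_fun_calc_unique:
  assumes X: "selfadjoint_op H X" and Y: "is_fun_calc H f X Y" and Z: "is_fun_calc H f X Z"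
  shows "Y = Z"
proof
  fix x
  show "Y x = Z x"
  proof (cases "x \<in> vecs H")
    case True
    note V = bounded_op_vecs[OF is_fun_calc_bounded[OF Y] True]
      bounded_op_vecs[OF is_fun_calc_bounded[OF Z] True] poly_op_vecs[OF X True]
    have bound: "hnorm H (Y x - Z x) \<le> e * (4 * hnorm H x)" if e: "0 < e" for e
    proof -
      obtain p where p: "poly_approx f X Y e p" using is_fun_calc_approx[OF Y e] .
      obtain q where q: "poly_approx f X Z e q" using is_fun_calc_approx[OF Z e] .
      have "hnorm H (poly_op H (p - q) X x) \<le> (2 * e) * hnorm H x"
      proof (rule poly_op_norm_le[OF X _ _ True])
        fix t assume "of_real t \<in> op_spectrum H X"
        then show "\<bar>poly (p - q) t\<bar> \<le> 2 * e"
          using poly_approxD(1)[OF p, of t] poly_approxD(1)[OF q, of t] by simp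
      qed (use e in simp)
      then have "hnorm H (poly_op H p X x - poly_op H q X x) \<le> 2 * (e * hnorm H x)"
        by (simp add: poly_op_diff[OF X True])
      moreover have "hnorm H (Y x - Z x) \<le> hnorm H (Y x - poly_op H p X x) +
          (hnorm H (poly_op H p X x - poly_op H q X x) + hnorm H (poly_op H q X x - Z x))"
        using hnorm_triangle_diff[of "Y x" "poly_op H p X x" "Z x"]
          hnorm_triangle_diff[of "poly_op H p X x" "poly_op H q X x" "Z x"] V by simp
      ultimately show ?thesis
        using poly_approxD(2)[OF p True] poly_approxD(2)[OF q True]
          hnorm_diff_commute[of "Y x" "poly_op H p X x"] V by simp
    qed
    then have "hnorm H (Y x - Z x) \<le> 0"
      by (rule nonpos_if_le_all_multiples)
    then show ?thesis
      using V by (intro eq_if_hnorm_small) auto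
  next
    case False
    then show ?thesis using Y Z by (simp add: is_fun_calc_def)
  qed
qed

lemma fun_calc_eqI:
  "selfadjoint_op H X \<Longrightarrow> is_fun_calc H f X Y \<Longrightarrow> fun_calc H f X = Y"
  unfolding fun_calc_def by (rule the_equality) (auto dest: is_fun_calc_unique)

text \<open>
  Linearity of \<open>Y\<close> is a conclusion here, so that \<open>Y\<close> may be a mere pointwise limit.
\<close>

lemma uniformly_approximable_selfadjoint:
  assumes YV: "\<And>x. x \<in> vecs H \<Longrightarrow> Y x \<in> vecs H"
    and approx: "\<And>e. 0 < e \<Longrightarrow> \<exists>T. selfadjoint_op H T \<and>
        (\<forall>x\<in>vecs H. hnorm H (T x - Y x) \<le> e * hnorm H x)"
  shows "selfadjoint_op H Y"
proof -
  have eqI: "u = v" if "u \<in> vecs H" "v \<in> vecs H" "\<And>e. 0 < e \<Longrightarrow> hnorm H (u - v) \<le> e * c" for u v c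
  proof (rule eq_if_hnorm_small[OF that(1,2)])
    fix e :: real assume "0 < e"
    then show "hnorm H (u - v) \<le> e"
      using nonpos_if_le_all_multiples[OF that(3)] by linarith
  qed
  obtain T where T: "selfadjoint_op H T" "\<And>x. x \<in> vecs H \<Longrightarrow> hnorm H (T x - Y x) \<le> 1 * hnorm H x"
    using approx[of 1] by auto
  obtain b where b: "\<And>x. x \<in> vecs H \<Longrightarrow> hnorm H (T x) \<le> b * hnorm H x"
    using bounded_op_bound[OF selfadjoint_opD(1)[OF T(1)]] by blast
  have "bounded_op H Y"
  proof (rule bounded_opI[where b = "b + 1"])
    fix x assume x: "x \<in> vecs H"
    have "hnorm H (Y x) \<le> hnorm H (Y x - T x) + hnorm H (T x)"
      using hnorm_triangle[of "Y x - T x" "T x"] YV[OF x] selfadjoint_op_vecs[OF T(1) x] by simp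
    then show "hnorm H (Y x) \<le> (b + 1) * hnorm H x"
      using b[OF x] T(2)[OF x] hnorm_diff_commute[OF YV[OF x] selfadjoint_op_vecs[OF T(1) x]]
      by (simp add: algebra_simps)
  next
    fix x y assume x: "x \<in> vecs H" and y: "y \<in> vecs H"
    show "Y (x + y) = Y x + Y y"
    proof (rule eqI[where c = "hnorm H (x + y) + (hnorm H x + hnorm H y)"])
      fix e :: real assume "0 < e"
      then obtain T where T: "selfadjoint_op H T"
        "\<And>x. x \<in> vecs H \<Longrightarrow> hnorm H (T x - Y x) \<le> e * hnorm H x"
        using approx by blast
      note V = YV selfadjoint_op_vecs[OF T(1)]
      have eq: "T (x + y) - (Y x + Y y) = (T x - Y x) + (T y - Y y)"
        using x y by (simp add: bounded_op_add[OF selfadjoint_opD(1)[OF T(1)]])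
      have "hnorm H (T (x + y) - (Y x + Y y)) \<le> e * hnorm H x + e * hnorm H y"
        unfolding eq by (rule order_trans[OF hnorm_triangle add_mono]) (use T(2) x y V in auto)
      moreover have "hnorm H (Y (x + y) - T (x + y)) \<le> e * hnorm H (x + y)"
        using T(2)[of "x + y"] hnorm_diff_commute[of "Y (x + y)" "T (x + y)"] x y V by simp
      ultimately show "hnorm H (Y (x + y) - (Y x + Y y)) \<le>
          e * (hnorm H (x + y) + (hnorm H x + hnorm H y))"
        using hnorm_triangle_diff[of "Y (x + y)" "T (x + y)" "Y x + Y y"] x y V
        by (simp add: distrib_left)
    qed (use x y YV in auto)
  next
    fix z x assume x: "x \<in> vecs H"
    show "Y (scl H z x) = scl H z (Y x)"
    proof (rule eqI[where c = "hnorm H (scl H z x) + cmod z * hnorm H x"])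
      fix e :: real assume "0 < e"
      then obtain T where T: "selfadjoint_op H T"
        "\<And>x. x \<in> vecs H \<Longrightarrow> hnorm H (T x - Y x) \<le> e * hnorm H x"
        using approx by blast
      note V = YV selfadjoint_op_vecs[OF T(1)]
      have "T (scl H z x) - scl H z (Y x) = scl H z (T x - Y x)"
        using x by (simp add: bounded_op_scl[OF selfadjoint_opD(1)[OF T(1)]]
            scaling.scale_right_diff_distrib)
      then have "hnorm H (T (scl H z x) - scl H z (Y x)) \<le> cmod z * (e * hnorm H x)"
        using T(2)[OF x] x V by (simp add: hnorm_scl mult_left_mono)
      moreover have "hnorm H (Y (scl H z x) - T (scl H z x)) \<le> e * hnorm H (scl H z x)"
        using T(2)[of "scl H z x"] hnorm_diff_commute[of "Y (scl H z x)" "T (scl H z x)"] x V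
        by simp
      ultimately show "hnorm H (Y (scl H z x) - scl H z (Y x)) \<le>
          e * (hnorm H (scl H z x) + cmod z * hnorm H x)"
        using hnorm_triangle_diff[of "Y (scl H z x)" "T (scl H z x)" "scl H z (Y x)"] x V
        by (simp add: distrib_left mult.left_commute)
    qed (use x YV in auto)
  qed (use YV in auto)
  moreover have "ip H (Y x) y = ip H x (Y y)" if x: "x \<in> vecs H" and y: "y \<in> vecs H" for x y
  proof -
    have "cmod (ip H (Y x) y - ip H x (Y y)) \<le> e * (2 * (hnorm H x * hnorm H y))" if e: "0 < e" for e
    proof -
      obtain T where T: "selfadjoint_op H T"
        "\<And>x. x \<in> vecs H \<Longrightarrow> hnorm H (T x - Y x) \<le> e * hnorm H x"
        using approx[OF e] by blast
      note V = YV selfadjoint_op_vecs[OF T(1)]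
      have "ip H (Y x) y - ip H x (Y y) = ip H x (T y - Y y) - ip H (T x - Y x) y"
        using x y V selfadjoint_opD(2)[OF T(1) x y] by (simp add: ip_simps)
      then have "cmod (ip H (Y x) y - ip H x (Y y)) \<le>
          hnorm H x * hnorm H (T y - Y y) + hnorm H (T x - Y x) * hnorm H y"
        using norm_triangle_ineq4[of "ip H x (T y - Y y)" "ip H (T x - Y x) y"]
          Cauchy_Schwarz[of x "T y - Y y"] Cauchy_Schwarz[of "T x - Y x" y] x y V by simp
      also have "\<dots> \<le> hnorm H x * (e * hnorm H y) + (e * hnorm H x) * hnorm H y"
        using T(2)[OF x] T(2)[OF y] x y by (intro add_mono mult_left_mono mult_right_mono) auto
      finally show ?thesis by (simp add: algebra_simps)
    qed
    then have "cmod (ip H (Y x) y - ip H x (Y y)) \<le> 0"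
      by (rule nonpos_if_le_all_multiples)
    then show ?thesis by simp
  qed
  ultimately show ?thesis by (simp add: selfadjoint_op_def)
qed

lemma is_fun_calc_selfadjoint:
  assumes X: "selfadjoint_op H X" and Y: "is_fun_calc H f X Y"
  shows "selfadjoint_op H Y"
proof (rule uniformly_approximable_selfadjoint)
  fix e :: real assume "0 < e"
  then obtain p where "poly_approx f X Y e p" using is_fun_calc_approx[OF Y] by blast
  then show "\<exists>T. selfadjoint_op H T \<and> (\<forall>x\<in>vecs H. hnorm H (T x - Y x) \<le> e * hnorm H x)"
    using selfadjoint_op_poly_op[OF X] poly_approxD(2) by blast
qed (rule bounded_op_vecs[OF is_fun_calc_bounded[OF Y]])

text \<open>
  Polynomials that approximate \<open>f\<close> within \<open>2\<^sup>-\<^sup>k\<close> on the spectrum have values at \<open>X\<close> whose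
  consecutive differences decay geometrically, so they converge at every vector.
\<close>

lemma is_fun_calc_exists:
  assumes X: "selfadjoint_op H X"
    and f: "\<And>e. 0 < e \<Longrightarrow> \<exists>p. \<forall>t. of_real t \<in> op_spectrum H X \<longrightarrow> \<bar>poly p t - f t\<bar> \<le> e"
  shows "\<exists>Y. is_fun_calc H f X Y"
proof -
  have "\<forall>k. \<exists>p. \<forall>t. of_real t \<in> op_spectrum H X \<longrightarrow> \<bar>poly p t - f t\<bar> \<le> (1 / 2) ^ k"
    using f by simp
  then obtain P where P: "\<And>k t. of_real t \<in> op_spectrum H X \<Longrightarrow> \<bar>poly (P k) t - f t\<bar> \<le> (1 / 2 :: real) ^ k"
    by metis
  note V = poly_op_vecs[OF X]
  have diff: "hnorm H (poly_op H (P j) X x - poly_op H (P k) X x) \<le> ((1 / 2) ^ j + (1 / 2) ^ k) * hnorm H x"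
    if x: "x \<in> vecs H" for j k x
  proof -
    have "hnorm H (poly_op H (P j - P k) X x) \<le> ((1 / 2) ^ j + (1 / 2) ^ k) * hnorm H x"
    proof (rule poly_op_norm_le[OF X _ _ x])
      fix t assume "of_real t \<in> op_spectrum H X"
      then show "\<bar>poly (P j - P k) t\<bar> \<le> (1 / 2) ^ j + (1 / 2) ^ k"
        using P[of t j] P[of t k] by simp
    qed simp
    then show ?thesis by (simp add: poly_op_diff[OF X x])
  qed
  have "\<exists>l. l \<in> vecs H \<and> (\<lambda>k. hnorm H (poly_op H (P k) X x - l)) \<longlonglongrightarrow> 0" if x: "x \<in> vecs H" for x
  proof -
    have "hnorm H (poly_op H (P (Suc k)) X x - poly_op H (P k) X x) \<le> (1 / 2) ^ k * (2 * hnorm H x)" for k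
    proof -
      have "((1 / 2) ^ Suc k + (1 / 2) ^ k) * hnorm H x \<le> (2 * (1 / 2 :: real) ^ k) * hnorm H x"
        using x by (intro mult_right_mono) auto
      then show ?thesis using diff[OF x, of "Suc k" k] by (simp add: mult_ac)
    qed
    then obtain l where "l \<in> vecs H" "(\<lambda>k. hnorm H (poly_op H (P k) X x - l)) \<longlonglongrightarrow> 0"
      using geometric_steps_converge[of "\<lambda>k. poly_op H (P k) X x" "1 / 2"] V[OF x] by auto
    then show ?thesis by blast
  qed
  then obtain L where L: "\<And>x. x \<in> vecs H \<Longrightarrow> L x \<in> vecs H"
    "\<And>x. x \<in> vecs H \<Longrightarrow> (\<lambda>k. hnorm H (poly_op H (P k) X x - L x)) \<longlonglongrightarrow> 0"
    by metis
  define Y where "Y = (\<lambda>x. if x \<in> vecs H then L x else 0)"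
  have rate: "hnorm H (poly_op H (P k) X x - Y x) \<le> (1 / 2) ^ k * hnorm H x" if x: "x \<in> vecs H" for k x
  proof (rule LIMSEQ_le_const)
    have half: "(\<lambda>j. (1 / 2 :: real) ^ j) \<longlonglongrightarrow> 0"
      by (rule LIMSEQ_power_zero) simp
    have "(\<lambda>j. ((1 / 2) ^ k + (1 / 2) ^ j) * hnorm H x + hnorm H (poly_op H (P j) X x - L x))
        \<longlonglongrightarrow> ((1 / 2) ^ k + 0) * hnorm H x + 0"
      by (intro tendsto_add tendsto_mult tendsto_const half L(2)[OF x])
    then show "(\<lambda>j. ((1 / 2) ^ k + (1 / 2) ^ j) * hnorm H x + hnorm H (poly_op H (P j) X x - L x))
        \<longlonglongrightarrow> (1 / 2) ^ k * hnorm H x"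
      by simp
    show "\<exists>N. \<forall>j\<ge>N. hnorm H (poly_op H (P k) X x - Y x) \<le>
        ((1 / 2) ^ k + (1 / 2) ^ j) * hnorm H x + hnorm H (poly_op H (P j) X x - L x)"
    proof (intro exI allI impI)
      fix j :: nat
      have "hnorm H (poly_op H (P k) X x - L x) \<le>
          hnorm H (poly_op H (P k) X x - poly_op H (P j) X x) + hnorm H (poly_op H (P j) X x - L x)"
        by (rule hnorm_triangle_diff) (use x V L in auto)
      then show "hnorm H (poly_op H (P k) X x - Y x) \<le>
          ((1 / 2) ^ k + (1 / 2) ^ j) * hnorm H x + hnorm H (poly_op H (P j) X x - L x)"
        using diff[OF x, of k j] x by (simp add: Y_def)
    qed
  qed
  have approx: "\<exists>p. poly_approx f X Y e p" if e: "0 < e" for e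
  proof -
    obtain k where k: "(1 / 2 :: real) ^ k < e"
      using real_arch_pow_inv[OF e, of "1 / 2"] by auto
    have "poly_approx f X Y e (P k)"
      unfolding poly_approx_def
    proof (intro conjI allI ballI impI)
      fix t assume "of_real t \<in> op_spectrum H X"
      then show "\<bar>poly (P k) t - f t\<bar> \<le> e" using P[of t k] k by linarith
    next
      fix x assume x: "x \<in> vecs H"
      have "(1 / 2) ^ k * hnorm H x \<le> e * hnorm H x"
        using k x by (intro mult_right_mono) auto
      then show "hnorm H (poly_op H (P k) X x - Y x) \<le> e * hnorm H x"
        using rate[OF x, of k] by linarith
    qed
    then show ?thesis ..
  qed
  have "selfadjoint_op H Y"
  proof (rule uniformly_approximable_selfadjoint)
    fix e :: real assume "0 < e"
    then obtain p where "poly_approx f X Y e p" using approx by blast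
    then show "\<exists>T. selfadjoint_op H T \<and> (\<forall>x\<in>vecs H. hnorm H (T x - Y x) \<le> e * hnorm H x)"
      using selfadjoint_op_poly_op[OF X] poly_approxD(2) by blast
  qed (simp add: Y_def L)
  then have "is_fun_calc H f X Y"
    using approx by (auto simp: is_fun_calc_iff selfadjoint_opD(1) Y_def)
  then show ?thesis by blast
qed

lemma fun_calc_correct:
  assumes X: "form_range X a b" and f: "continuous_on {a..b} f"
  shows "is_fun_calc H f X (fun_calc H f X)"
proof -
  have "\<exists>p. \<forall>t. of_real t \<in> op_spectrum H X \<longrightarrow> \<bar>poly p t - f t\<bar> \<le> e" if e: "0 < e" for e
  proof -
    obtain g where g: "real_polynomial_function g" "\<And>t. t \<in> {a..b} \<Longrightarrow> \<bar>f t - g t\<bar> < e"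
      by (rule Stone_Weierstrass_real_polynomial_function[OF compact_Icc f e]) blast
    then obtain c n where "g = (\<lambda>t. \<Sum>i\<le>n. c i * t ^ i)"
      by (auto simp: real_polynomial_function_iff_sum)
    then have poly_eq: "poly (\<Sum>i\<le>n. monom (c i) i) = g"
      by (simp add: poly_sum poly_monom fun_eq_iff)
    show ?thesis
    proof (intro exI allI impI)
      fix t assume "of_real t \<in> op_spectrum H X"
      then show "\<bar>poly (\<Sum>i\<le>n. monom (c i) i) t - f t\<bar> \<le> e"
        unfolding poly_eq using g(2) spectrum_in_form_range[OF X] by force
    qed
  qed
  then obtain Y where "is_fun_calc H f X Y"
    using is_fun_calc_exists[OF form_range_selfadjoint[OF X]] by blast
  then show ?thesis
    using fun_calc_eqI[OF form_range_selfadjoint[OF X]] by simp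
qed

lemma fun_calc_selfadjoint:
  "form_range X a b \<Longrightarrow> continuous_on {a..b} f \<Longrightarrow> selfadjoint_op H (fun_calc H f X)"
  by (rule is_fun_calc_selfadjoint[OF form_range_selfadjoint fun_calc_correct])

lemma fun_calc_cong:
  assumes X: "form_range X a b" and g: "continuous_on {a..b} g"
    and "\<And>t. t \<in> {a..b} \<Longrightarrow> f t = g t"
  shows "fun_calc H f X = fun_calc H g X"
  using X by (intro fun_calc_eqI is_fun_calc_cong[OF fun_calc_correct[OF X g]])
    (rule form_range_selfadjoint, assumption, rule assms(3), rule spectrum_in_form_range)

lemma fun_calc_poly:
  assumes X: "form_range X a b" and x: "x \<in> vecs H"
  shows "fun_calc H (poly p) X x = poly_op H p X x"
proof -
  have sa: "selfadjoint_op H X" using X by (rule form_range_selfadjoint)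
  have "is_fun_calc H (poly p) X (\<lambda>x. if x \<in> vecs H then poly_op H p X x else 0)"
    unfolding is_fun_calc_iff
  proof (intro conjI allI impI)
    have "selfadjoint_op H (\<lambda>x. if x \<in> vecs H then poly_op H p X x else 0)"
      by (rule selfadjoint_op_cong[OF selfadjoint_op_poly_op[OF sa]]) simp
    then show "bounded_op H (\<lambda>x. if x \<in> vecs H then poly_op H p X x else 0)"
      by (rule selfadjoint_opD)
    fix e :: real assume "0 < e"
    then show "\<exists>q. poly_approx (poly p) X (\<lambda>x. if x \<in> vecs H then poly_op H p X x else 0) e q"
      by (intro exI[of _ p]) (simp add: poly_approx_def)
  qed simp
  then show ?thesis
    using fun_calc_eqI[OF sa] x by simp
qed

lemma fun_calc_ident:
  assumes X: "form_range X a b" and x: "x \<in> vecs H"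
  shows "fun_calc H (\<lambda>t. t) X x = X x"
proof -
  have "poly [:0, 1:] = (\<lambda>t :: real. t)" by (simp add: fun_eq_iff)
  then show ?thesis
    using fun_calc_poly[OF X x, of "[:0, 1:]"] x
    by (simp add: poly_op_linear[OF form_range_selfadjoint[OF X]])
qed

lemma fun_calc_const:
  assumes X: "form_range X a b" and x: "x \<in> vecs H"
  shows "fun_calc H (\<lambda>t. c) X x = scl H (of_real c) x"
proof -
  have "poly [:c:] = (\<lambda>t. c)" by (simp add: fun_eq_iff)
  then show ?thesis
    using fun_calc_poly[OF X x, of "[:c:]"] x
    by (simp add: poly_op_const[OF form_range_selfadjoint[OF X]])
qed

lemma fun_calc_lincomb:
  assumes X: "form_range X a b" and f: "continuous_on {a..b} f" and g: "continuous_on {a..b} g"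
    and x: "x \<in> vecs H"
  shows "fun_calc H (\<lambda>t. c * f t + d * g t) X x =
    scl H (of_real c) (fun_calc H f X x) + scl H (of_real d) (fun_calc H g X x)"
proof -
  have sa: "selfadjoint_op H X" using X by (rule form_range_selfadjoint)
  define F G where "F = fun_calc H f X" and "G = fun_calc H g X"
  have F: "is_fun_calc H f X F" and G: "is_fun_calc H g X G"
    using fun_calc_correct[OF X] f g by (auto simp: F_def G_def)
  have FV: "F x \<in> vecs H" and GV: "G x \<in> vecs H" if "x \<in> vecs H" for x
    using F G that by (auto intro: bounded_op_vecs is_fun_calc_bounded)
  have "is_fun_calc H (\<lambda>t. c * f t + d * g t) X (op_scale H c F + op_scale H d G)"
    unfolding is_fun_calc_iff
  proof (intro conjI allI impI)
    show "bounded_op H (op_scale H c F + op_scale H d G)"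
      using F G by (intro bounded_op_plus bounded_op_op_scale is_fun_calc_bounded)
  next
    fix x assume "x \<notin> vecs H"
    then show "(op_scale H c F + op_scale H d G) x = 0"
      using F G by (simp add: op_scale_def is_fun_calc_def)
  next
    fix e :: real assume "0 < e"
    define s where "s = \<bar>c\<bar> + \<bar>d\<bar> + 1"
    define \<epsilon> where "\<epsilon> = e / s"
    have "0 < s" by (simp add: s_def)
    then have "0 < \<epsilon>" using \<open>0 < e\<close> by (simp add: \<epsilon>_def)
    have sum_le: "\<bar>c\<bar> * (\<epsilon> * r) + \<bar>d\<bar> * (\<epsilon> * r) \<le> e * r" if "0 \<le> r" for r
    proof -
      have "\<bar>c\<bar> * (\<epsilon> * r) + \<bar>d\<bar> * (\<epsilon> * r) \<le> s * (\<epsilon> * r)"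
        using \<open>0 < \<epsilon>\<close> that by (simp add: s_def algebra_simps)
      then show ?thesis
        using \<open>0 < s\<close> by (simp add: \<epsilon>_def)
    qed
    obtain p where p: "poly_approx f X F \<epsilon> p" using is_fun_calc_approx[OF F \<open>0 < \<epsilon>\<close>] .
    obtain q where q: "poly_approx g X G \<epsilon> q" using is_fun_calc_approx[OF G \<open>0 < \<epsilon>\<close>] .
    have "poly_approx (\<lambda>t. c * f t + d * g t) X (op_scale H c F + op_scale H d G) e
        (smult c p + smult d q)"
      unfolding poly_approx_def
    proof (intro conjI allI ballI impI)
      fix t assume t: "of_real t \<in> op_spectrum H X"
      have "\<bar>poly (smult c p + smult d q) t - (c * f t + d * g t)\<bar> =
          \<bar>c * (poly p t - f t) + d * (poly q t - g t)\<bar>"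
        by (simp add: algebra_simps)
      also have "\<dots> \<le> \<bar>c\<bar> * \<bar>poly p t - f t\<bar> + \<bar>d\<bar> * \<bar>poly q t - g t\<bar>"
        unfolding abs_mult[symmetric] by (rule abs_triangle_ineq)
      also have "\<dots> \<le> \<bar>c\<bar> * (\<epsilon> * 1) + \<bar>d\<bar> * (\<epsilon> * 1)"
        using poly_approxD(1)[OF p t] poly_approxD(1)[OF q t]
        by (intro add_mono mult_left_mono) auto
      also have "\<dots> \<le> e * 1" by (rule sum_le) simp
      finally show "\<bar>poly (smult c p + smult d q) t - (c * f t + d * g t)\<bar> \<le> e" by simp
    next
      fix x assume x: "x \<in> vecs H"
      note V = FV[OF x] GV[OF x] poly_op_vecs[OF sa x]
      have "poly_op H (smult c p + smult d q) X x - (op_scale H c F + op_scale H d G) x =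
          scl H (of_real c) (poly_op H p X x - F x) + scl H (of_real d) (poly_op H q X x - G x)"
        by (simp add: poly_op_add[OF sa x] poly_op_smult[OF sa x] op_scale_def
            scaling.scale_right_diff_distrib)
      also have "hnorm H \<dots> \<le> hnorm H (scl H (of_real c) (poly_op H p X x - F x)) +
          hnorm H (scl H (of_real d) (poly_op H q X x - G x))"
        using V by (intro hnorm_triangle) auto
      also have "\<dots> = \<bar>c\<bar> * hnorm H (poly_op H p X x - F x) + \<bar>d\<bar> * hnorm H (poly_op H q X x - G x)"
        using V by (simp add: hnorm_scl)
      also have "\<dots> \<le> \<bar>c\<bar> * (\<epsilon> * hnorm H x) + \<bar>d\<bar> * (\<epsilon> * hnorm H x)"
        using poly_approxD(2)[OF p x] poly_approxD(2)[OF q x]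
        by (intro add_mono mult_left_mono) auto
      also have "\<dots> \<le> e * hnorm H x" by (rule sum_le) (use x in simp)
      finally show "hnorm H (poly_op H (smult c p + smult d q) X x -
          (op_scale H c F + op_scale H d G) x) \<le> e * hnorm H x" .
    qed
    then show "\<exists>r. poly_approx (\<lambda>t. c * f t + d * g t) X (op_scale H c F + op_scale H d G) e r" ..
  qed
  then show ?thesis
    using fun_calc_eqI[OF sa] by (simp add: op_scale_def F_def G_def)
qed

lemma fun_calc_mult:
  assumes X: "form_range X a b" and f: "continuous_on {a..b} f" and g: "continuous_on {a..b} g"
    and x: "x \<in> vecs H"
  shows "fun_calc H (\<lambda>t. f t * g t) X x = fun_calc H f X (fun_calc H g X x)"
proof -
  have sa: "selfadjoint_op H X" using X by (rule form_range_selfadjoint)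
  define F G where "F = fun_calc H f X" and "G = fun_calc H g X"
  have F: "is_fun_calc H f X F" and G: "is_fun_calc H g X G"
    using fun_calc_correct[OF X] f g by (auto simp: F_def G_def)
  have FV: "F x \<in> vecs H" and GV: "G x \<in> vecs H" if "x \<in> vecs H" for x
    using F G that by (auto intro: bounded_op_vecs is_fun_calc_bounded)
  have "bounded (f ` {a..b})" "bounded (g ` {a..b})"
    using compact_continuous_image[OF f compact_Icc] compact_continuous_image[OF g compact_Icc]
    by (auto intro: compact_imp_bounded)
  then obtain Kf Kg where "\<forall>t\<in>{a..b}. \<bar>f t\<bar> \<le> Kf" "\<forall>t\<in>{a..b}. \<bar>g t\<bar> \<le> Kg"
    by (auto simp: bounded_iff)
  define K where "K = max 0 (max Kf Kg)"
  have K: "0 \<le> K" "\<bar>f t\<bar> \<le> K" "\<bar>g t\<bar> \<le> K" if "of_real t \<in> op_spectrum H X" for t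
    using spectrum_in_form_range[OF X that] \<open>\<forall>t\<in>{a..b}. \<bar>f t\<bar> \<le> Kf\<close> \<open>\<forall>t\<in>{a..b}. \<bar>g t\<bar> \<le> Kg\<close>
    by (auto simp: K_def le_max_iff_disj)
  have "0 \<le> K" by (simp add: K_def)
  obtain L where L: "0 < L" "\<And>x. x \<in> vecs H \<Longrightarrow> hnorm H (G x) \<le> L * hnorm H x"
    using bounded_op_bound[OF is_fun_calc_bounded[OF G]] by blast
  have "is_fun_calc H (\<lambda>t. f t * g t) X (F \<circ> G)"
    unfolding is_fun_calc_iff
  proof (intro conjI allI impI)
    show "bounded_op H (F \<circ> G)"
      using F G by (intro bounded_op_comp is_fun_calc_bounded)
  next
    fix x assume "x \<notin> vecs H"
    then show "(F \<circ> G) x = 0"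
      using G bounded_op_diff[OF is_fun_calc_bounded[OF F], of 0 0] by (simp add: is_fun_calc_def)
  next
    fix e :: real assume "0 < e"
    \<comment> \<open>Approximants within \<open>\<epsilon> \<le> 1\<close> are bounded by \<open>K + 1\<close>; the product errors are then at most
      \<open>(K + 1) \<epsilon> + K \<epsilon>\<close> on the spectrum and \<open>(K + 1) \<epsilon> + L \<epsilon>\<close> in norm, both covered by \<open>s \<epsilon>\<close>.\<close>
    define s where "s = (K + 1) + K + L"
    define \<epsilon> where "\<epsilon> = min 1 (e / s)"
    have "0 < s" using \<open>0 \<le> K\<close> L(1) by (simp add: s_def)
    then have "0 < \<epsilon>" "\<epsilon> \<le> 1" using \<open>0 < e\<close> by (auto simp: \<epsilon>_def)
    have "s * \<epsilon> \<le> s * (e / s)"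
      using \<open>0 < s\<close> by (intro mult_left_mono) (auto simp: \<epsilon>_def)
    then have s\<epsilon>: "s * \<epsilon> \<le> e" using \<open>0 < s\<close> by simp
    obtain p where p: "poly_approx f X F \<epsilon> p" using is_fun_calc_approx[OF F \<open>0 < \<epsilon>\<close>] .
    obtain q where q: "poly_approx g X G \<epsilon> q" using is_fun_calc_approx[OF G \<open>0 < \<epsilon>\<close>] .
    have pK: "\<bar>poly p t\<bar> \<le> K + 1" if "of_real t \<in> op_spectrum H X" for t
      using poly_approxD(1)[OF p that] K(2)[OF that] \<open>\<epsilon> \<le> 1\<close> by linarith
    have "poly_approx (\<lambda>t. f t * g t) X (F \<circ> G) e (p * q)"
      unfolding poly_approx_def
    proof (intro conjI allI ballI impI)
      fix t assume t: "of_real t \<in> op_spectrum H X"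
      have "\<bar>poly (p * q) t - f t * g t\<bar> = \<bar>poly p t * (poly q t - g t) + g t * (poly p t - f t)\<bar>"
        by (simp add: algebra_simps)
      also have "\<dots> \<le> \<bar>poly p t\<bar> * \<bar>poly q t - g t\<bar> + \<bar>g t\<bar> * \<bar>poly p t - f t\<bar>"
        unfolding abs_mult[symmetric] by (rule abs_triangle_ineq)
      also have "\<dots> \<le> (K + 1) * \<epsilon> + K * \<epsilon>"
        using poly_approxD(1)[OF p t] poly_approxD(1)[OF q t] pK[OF t] K[OF t]
        by (intro add_mono mult_mono) auto
      also have "\<dots> \<le> s * \<epsilon>"
        using L(1) \<open>0 < \<epsilon>\<close> by (simp add: s_def algebra_simps)
      finally show "\<bar>poly (p * q) t - f t * g t\<bar> \<le> e" using s\<epsilon> by linarith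
    next
      fix x assume x: "x \<in> vecs H"
      note V = FV GV[OF x] poly_op_vecs[OF sa x] poly_op_vecs[OF sa GV[OF x]]
        poly_op_vecs[OF sa poly_op_vecs[OF sa x]]
      have "poly_op H (p * q) X x - (F \<circ> G) x =
          poly_op H p X (poly_op H q X x - G x) + (poly_op H p X (G x) - F (G x))"
        using V by (simp add: poly_op_mult[OF sa x]
            bounded_op_diff[OF selfadjoint_opD(1)[OF selfadjoint_op_poly_op[OF sa]]])
      also have "hnorm H \<dots> \<le> hnorm H (poly_op H p X (poly_op H q X x - G x)) +
          hnorm H (poly_op H p X (G x) - F (G x))"
        using V by (intro hnorm_triangle) (auto intro: poly_op_vecs[OF sa])
      also have "\<dots> \<le> (K + 1) * (\<epsilon> * hnorm H x) + \<epsilon> * (L * hnorm H x)"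
      proof (rule add_mono)
        have "hnorm H (poly_op H p X (poly_op H q X x - G x)) \<le> (K + 1) * hnorm H (poly_op H q X x - G x)"
          using V \<open>0 \<le> K\<close> pK by (intro poly_op_norm_le[OF sa]) auto
        also have "\<dots> \<le> (K + 1) * (\<epsilon> * hnorm H x)"
          using \<open>0 \<le> K\<close> poly_approxD(2)[OF q x] by (intro mult_left_mono) auto
        finally show "hnorm H (poly_op H p X (poly_op H q X x - G x)) \<le> (K + 1) * (\<epsilon> * hnorm H x)" .
        have "hnorm H (poly_op H p X (G x) - F (G x)) \<le> \<epsilon> * hnorm H (G x)"
          using poly_approxD(2)[OF p GV[OF x]] .
        also have "\<dots> \<le> \<epsilon> * (L * hnorm H x)"
          using L(2)[OF x] \<open>0 < \<epsilon>\<close> by (intro mult_left_mono) auto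
        finally show "hnorm H (poly_op H p X (G x) - F (G x)) \<le> \<epsilon> * (L * hnorm H x)" .
      qed
      also have "\<dots> \<le> (s * \<epsilon>) * hnorm H x"
        using \<open>0 \<le> K\<close> \<open>0 < \<epsilon>\<close> x by (simp add: s_def algebra_simps)
      also have "\<dots> \<le> e * hnorm H x"
        using s\<epsilon> x by (intro mult_right_mono) auto
      finally show "hnorm H (poly_op H (p * q) X x - (F \<circ> G) x) \<le> e * hnorm H x" .
    qed
    then show "\<exists>r. poly_approx (\<lambda>t. f t * g t) X (F \<circ> G) e r" ..
  qed
  then show ?thesis
    using fun_calc_eqI[OF sa] by (simp add: F_def G_def)
qed

text \<open>
  If \<open>p\<close> and \<open>q\<close> are within \<open>e\<close> of \<open>f \<le> g\<close>, then \<open>q - p + 2 e\<close> is nonnegative on the spectrum.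
\<close>

lemma fun_calc_mono:
  assumes X: "form_range X a b" and f: "continuous_on {a..b} f" and g: "continuous_on {a..b} g"
    and le: "\<And>t. t \<in> {a..b} \<Longrightarrow> f t \<le> g t" and x: "x \<in> vecs H"
  shows "Re (ip H (fun_calc H f X x) x) \<le> Re (ip H (fun_calc H g X x) x)"
proof -
  have sa: "selfadjoint_op H X" using X by (rule form_range_selfadjoint)
  define F G where "F = fun_calc H f X" and "G = fun_calc H g X"
  have F: "is_fun_calc H f X F" and G: "is_fun_calc H g X G"
    using fun_calc_correct[OF X] f g by (auto simp: F_def G_def)
  have FV: "F x \<in> vecs H" and GV: "G x \<in> vecs H"
    using F G x by (auto intro: bounded_op_vecs is_fun_calc_bounded)
  have near: "\<bar>Re (ip H u x) - Re (ip H v x)\<bar> \<le> e * (hnorm H x)\<^sup>2"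
    if "u \<in> vecs H" "v \<in> vecs H" "hnorm H (u - v) \<le> e * hnorm H x" for u v e
  proof -
    have "\<bar>Re (ip H u x) - Re (ip H v x)\<bar> = \<bar>Re (ip H (u - v) x)\<bar>"
      using that x by (simp add: ip_simps)
    also have "\<dots> \<le> hnorm H (u - v) * hnorm H x"
      using Cauchy_Schwarz[of "u - v" x] abs_Re_le_cmod[of "ip H (u - v) x"] that x by simp
    also have "\<dots> \<le> e * hnorm H x * hnorm H x"
      using that x by (intro mult_right_mono) auto
    finally show ?thesis by (simp add: power2_eq_square mult.assoc)
  qed
  have "Re (ip H (F x) x) - Re (ip H (G x) x) \<le> e * (4 * (hnorm H x)\<^sup>2)" if e: "0 < e" for e
  proof -
    obtain p where p: "poly_approx f X F e p" using is_fun_calc_approx[OF F e] .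
    obtain q where q: "poly_approx g X G e q" using is_fun_calc_approx[OF G e] .
    have V: "poly_op H p X x \<in> vecs H" "poly_op H q X x \<in> vecs H"
      using poly_op_vecs[OF sa x] by auto
    have "0 \<le> Re (ip H (poly_op H (q - p + [:2 * e:]) X x) x)"
    proof (rule poly_op_nonneg[OF sa _ x])
      fix t assume t: "of_real t \<in> op_spectrum H X"
      then show "0 \<le> poly (q - p + [:2 * e:]) t"
        using poly_approxD(1)[OF p t] poly_approxD(1)[OF q t]
          le[OF spectrum_in_form_range[OF X t]] by simp
    qed
    also have "poly_op H (q - p + [:2 * e:]) X x =
        poly_op H q X x - poly_op H p X x + scl H (of_real (2 * e)) x"
      by (simp only: poly_op_diff[OF sa x] poly_op_add[OF sa x] poly_op_const[OF sa x])
    also have "Re (ip H \<dots> x) =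
        Re (ip H (poly_op H q X x) x) - Re (ip H (poly_op H p X x) x) + 2 * e * (hnorm H x)\<^sup>2"
      using x V by (simp add: ip_simps hnorm_square del: of_real_mult)
    finally show ?thesis
      using near[OF V(1) FV poly_approxD(2)[OF p x]] near[OF V(2) GV poly_approxD(2)[OF q x]]
      by (simp add: abs_le_iff algebra_simps)
  qed
  then have "Re (ip H (F x) x) - Re (ip H (G x) x) \<le> 0"
    by (rule nonpos_if_le_all_multiples)
  then show ?thesis by (simp add: F_def G_def)
qed

section \<open>Operator perspectives\<close>

lemma strictly_positive_form_range:
  assumes "strictly_positive_op H A"
  obtains d b where "0 < d" "form_range A d b"
proof -
  have sa: "selfadjoint_op H A"
    using assms by (simp add: strictly_positive_op_def positive_op_def)
  obtain d where d: "0 < d" "\<And>x. x \<in> vecs H \<Longrightarrow> d * (hnorm H x)\<^sup>2 \<le> Re (ip H (A x) x)"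
    using positive_invertible_bounded_below assms unfolding strictly_positive_op_def by blast
  obtain b where b: "\<And>x. x \<in> vecs H \<Longrightarrow> \<bar>Re (ip H (A x) x)\<bar> \<le> b * (hnorm H x)\<^sup>2"
    using quad_bounded[OF sa] by blast
  have "Re (ip H (A x) x) \<le> b * (hnorm H x)\<^sup>2" if "x \<in> vecs H" for x
    using b[OF that] by linarith
  then have "form_range A d b"
    using sa d(2) by (simp add: form_range_def)
  then show ?thesis using that d(1) by blast
qed

lemma continuous_on_powr_Icc: "0 < d \<Longrightarrow> continuous_on {d..b} (\<lambda>t. t powr q :: real)"
  by (intro continuous_intros) auto

lemma op_powr_selfadjoint:
  "strictly_positive_op H A \<Longrightarrow> selfadjoint_op H (op_powr H A q)"
  unfolding op_powr_def
  by (metis strictly_positive_form_range fun_calc_selfadjoint continuous_on_powr_Icc)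

lemma op_powr_mult:
  assumes A: "strictly_positive_op H A" and x: "x \<in> vecs H"
  shows "op_powr H A q (op_powr H A r x) = op_powr H A (q + r) x"
proof -
  obtain d b where d: "0 < d" "form_range A d b"
    using strictly_positive_form_range[OF A] .
  show ?thesis
    unfolding op_powr_def powr_add
    using fun_calc_mult[OF d(2) continuous_on_powr_Icc continuous_on_powr_Icc x] d(1) by simp
qed

lemma op_powr_zero:
  assumes A: "strictly_positive_op H A" and x: "x \<in> vecs H"
  shows "op_powr H A 0 x = x"
proof -
  obtain d b where d: "0 < d" "form_range A d b"
    using strictly_positive_form_range[OF A] .
  have "fun_calc H (\<lambda>t. t powr 0) A = fun_calc H (\<lambda>t. 1) A"
    by (rule fun_calc_cong[OF d(2)]) (use d(1) in auto)
  then show ?thesis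
    using fun_calc_const[OF d(2) x, of 1] by (simp add: op_powr_def)
qed

lemma op_powr_one:
  assumes A: "strictly_positive_op H A" and x: "x \<in> vecs H"
  shows "op_powr H A 1 x = A x"
proof -
  obtain d b where d: "0 < d" "form_range A d b"
    using strictly_positive_form_range[OF A] .
  have "fun_calc H (\<lambda>t. t powr 1) A = fun_calc H (\<lambda>t. t) A"
    by (rule fun_calc_cong[OF d(2)]) (use d(1) in auto)
  then show ?thesis
    using fun_calc_ident[OF d(2) x] by (simp add: op_powr_def)
qed

lemma quad_op_powr_half:
  assumes A: "strictly_positive_op H A" and x: "x \<in> vecs H"
  shows "(hnorm H (op_powr H A (1 / 2) x))\<^sup>2 = Re (ip H (A x) x)"
proof -
  let ?R = "op_powr H A (1 / 2)"
  have R: "selfadjoint_op H ?R" using op_powr_selfadjoint[OF A] .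
  have Rx: "?R x \<in> vecs H" using selfadjoint_op_vecs[OF R x] .
  have "ip H (?R x) (?R x) = ip H (?R (?R x)) x"
    using selfadjoint_opD(2)[OF R Rx x] by simp
  then show ?thesis
    using op_powr_mult[OF A x, of "1 / 2" "1 / 2"] op_powr_one[OF A x] Rx by (simp add: hnorm_square)
qed

definition form_ratio :: "('a \<Rightarrow> 'a) \<Rightarrow> ('a \<Rightarrow> 'a) \<Rightarrow> real \<Rightarrow> real \<Rightarrow> bool" where
  "form_ratio A B m M \<longleftrightarrow> strictly_positive_op H A \<and>
    loewner_le H (op_scale H m A) B \<and> loewner_le H B (op_scale H M A)"

text \<open>
  The form of \<open>A\<^sup>-\<^sup>1\<^sup>/\<^sup>2 B A\<^sup>-\<^sup>1\<^sup>/\<^sup>2\<close> at \<open>x\<close> is that of \<open>B\<close> at \<open>y = A\<^sup>-\<^sup>1\<^sup>/\<^sup>2 x\<close>, and that of \<open>A\<close> at \<open>y\<close> is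
  \<open>\<parallel>x\<parallel>\<^sup>2\<close>.
\<close>

lemma form_range_rel_op:
  assumes "form_ratio A B m M"
  shows "form_range (rel_op H A B) m M"
proof -
  let ?R = "op_powr H A (- 1 / 2)"
  have A: "strictly_positive_op H A" and saA: "selfadjoint_op H A" and saB: "selfadjoint_op H B"
    using assms by (auto simp: form_ratio_def loewner_le_def strictly_positive_op_def positive_op_def)
  have le: "m * Re (ip H (A x) x) \<le> Re (ip H (B x) x)" "Re (ip H (B x) x) \<le> M * Re (ip H (A x) x)"
    if "x \<in> vecs H" for x
    using assms that by (auto simp: form_ratio_def loewner_le_iff quad_op_scale saA)
  have R: "selfadjoint_op H ?R" using op_powr_selfadjoint[OF A] .
  have "selfadjoint_op H (rel_op H A B)"
    unfolding rel_op_def using R saB by (rule selfadjoint_op_conjugation)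
  moreover have "Re (ip H (rel_op H A B x) x) = Re (ip H (B (?R x)) (?R x))" if x: "x \<in> vecs H" for x
    using selfadjoint_opD(2)[OF R _ x] selfadjoint_op_vecs[OF R x] selfadjoint_op_vecs[OF saB]
    by (simp add: rel_op_def)
  moreover have "Re (ip H (A (?R x)) (?R x)) = (hnorm H x)\<^sup>2" if x: "x \<in> vecs H" for x
  proof -
    have Rx: "?R x \<in> vecs H" using selfadjoint_op_vecs[OF R x] .
    have "op_powr H A (1 / 2) (?R x) = x"
      using op_powr_mult[OF A x, of "1 / 2" "- 1 / 2"] op_powr_zero[OF A x] by simp
    then show ?thesis
      using quad_op_powr_half[OF A Rx] by simp
  qed
  ultimately show ?thesis
    using le[OF selfadjoint_op_vecs[OF R]] unfolding form_range_def by metis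
qed

text \<open>
  \<open>A\<^sup>1\<^sup>/\<^sup>2 h(A\<^sup>-\<^sup>1\<^sup>/\<^sup>2 B A\<^sup>-\<^sup>1\<^sup>/\<^sup>2) A\<^sup>1\<^sup>/\<^sup>2\<close>, the operator version of \<open>a h(b / a)\<close>. Both \<open>A \<natural>\<^sub>q B\<close> and the
  relative entropy have this shape, so that scalar inequalities between the functions \<open>h\<close> become
  inequalities between them.
\<close>

definition perspective :: "(real \<Rightarrow> real) \<Rightarrow> ('a \<Rightarrow> 'a) \<Rightarrow> ('a \<Rightarrow> 'a) \<Rightarrow> 'a \<Rightarrow> 'a" where
  "perspective h A B = op_powr H A (1 / 2) \<circ> fun_calc H h (rel_op H A B) \<circ> op_powr H A (1 / 2)"

lemma natural_mean_eq_perspective: "natural_mean H q A B = perspective (\<lambda>t. t powr q) A B"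
  by (simp add: natural_mean_def perspective_def op_powr_def)

lemma form_ratio_strictly_positive: "form_ratio A B m M \<Longrightarrow> strictly_positive_op H A"
  by (simp add: form_ratio_def)

lemma op_powr_vecs: "form_ratio A B m M \<Longrightarrow> x \<in> vecs H \<Longrightarrow> op_powr H A q x \<in> vecs H"
  by (blast intro: selfadjoint_op_vecs op_powr_selfadjoint form_ratio_strictly_positive)

lemma rel_entropy_eq_perspective:
  assumes AB: "form_ratio A B m M" and m: "0 < m" and f: "continuous_on {m..M} f" and x: "x \<in> vecs H"
  shows "rel_entropy H f q A B x = perspective (\<lambda>t. t powr q * f t) A B x"
  using fun_calc_mult[OF form_range_rel_op[OF AB] continuous_on_powr_Icc[OF m] f
      op_powr_vecs[OF AB x]]
  by (simp add: rel_entropy_def perspective_def op_powr_def)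

lemma perspective_selfadjoint:
  assumes AB: "form_ratio A B m M" and h: "continuous_on {m..M} h"
  shows "selfadjoint_op H (perspective h A B)"
  unfolding perspective_def
  using AB h form_range_rel_op[OF AB]
  by (intro selfadjoint_op_conjugation op_powr_selfadjoint fun_calc_selfadjoint
      form_ratio_strictly_positive)

lemma quad_perspective:
  assumes AB: "form_ratio A B m M" and h: "continuous_on {m..M} h" and x: "x \<in> vecs H"
  shows "Re (ip H (perspective h A B x) x) = Re (ip H
    (fun_calc H h (rel_op H A B) (op_powr H A (1 / 2) x)) (op_powr H A (1 / 2) x))"
proof -
  have "selfadjoint_op H (op_powr H A (1 / 2))"
    using AB by (intro op_powr_selfadjoint form_ratio_strictly_positive)
  then show ?thesis
    using selfadjoint_opD(2)[of "op_powr H A (1 / 2)" _ x] x op_powr_vecs[OF AB x]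
      selfadjoint_op_vecs[OF fun_calc_selfadjoint[OF form_range_rel_op[OF AB] h]]
    by (simp add: perspective_def)
qed

lemma quad_perspective_mono:
  assumes AB: "form_ratio A B m M" and h: "continuous_on {m..M} h" and k: "continuous_on {m..M} k"
    and le: "\<And>t. t \<in> {m..M} \<Longrightarrow> h t \<le> k t" and x: "x \<in> vecs H"
  shows "Re (ip H (perspective h A B x) x) \<le> Re (ip H (perspective k A B x) x)"
  unfolding quad_perspective[OF AB h x] quad_perspective[OF AB k x]
  using form_range_rel_op[OF AB] h k le op_powr_vecs[OF AB x] by (rule fun_calc_mono)

lemma quad_perspective_lincomb:
  assumes AB: "form_ratio A B m M" and h: "continuous_on {m..M} h" and k: "continuous_on {m..M} k"
    and x: "x \<in> vecs H"
  shows "Re (ip H (perspective (\<lambda>t. c * h t + d * k t) A B x) x) =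
    c * Re (ip H (perspective h A B x) x) + d * Re (ip H (perspective k A B x) x)"
proof -
  have hk: "continuous_on {m..M} (\<lambda>t. c * h t + d * k t)"
    using h k by (intro continuous_intros)
  let ?y = "op_powr H A (1 / 2) x"
  have y: "?y \<in> vecs H" using op_powr_vecs[OF AB x] .
  have "fun_calc H h (rel_op H A B) ?y \<in> vecs H" "fun_calc H k (rel_op H A B) ?y \<in> vecs H"
    using form_range_rel_op[OF AB] h k y by (blast intro: selfadjoint_op_vecs fun_calc_selfadjoint)+
  then show ?thesis
    unfolding quad_perspective[OF AB h x] quad_perspective[OF AB k x] quad_perspective[OF AB hk x]
    using y by (simp add: fun_calc_lincomb[OF form_range_rel_op[OF AB] h k] ip_simps)
qed

lemma quad_perspective_one:
  assumes AB: "form_ratio A B m M" and x: "x \<in> vecs H"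
  shows "Re (ip H (perspective (\<lambda>t. 1) A B x) x) = Re (ip H (A x) x)"
proof -
  have y: "op_powr H A (1 / 2) x \<in> vecs H" using op_powr_vecs[OF AB x] .
  show ?thesis
    using fun_calc_const[OF form_range_rel_op[OF AB] y, of 1] quad_perspective[OF AB _ x, of "\<lambda>t. 1"]
      quad_op_powr_half[OF form_ratio_strictly_positive[OF AB] x] y
    by (simp add: hnorm_square)
qed

lemma quad_perspective_ident:
  assumes AB: "form_ratio A B m M" and x: "x \<in> vecs H"
  shows "Re (ip H (perspective (\<lambda>t. t) A B x) x) = Re (ip H (B x) x)"
proof -
  let ?y = "op_powr H A (1 / 2) x" and ?R = "op_powr H A (- 1 / 2)"
  have A: "strictly_positive_op H A" using form_ratio_strictly_positive[OF AB] .
  have y: "?y \<in> vecs H" using op_powr_vecs[OF AB x] .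
  have "?R ?y = x"
    using op_powr_mult[OF A x, of "- 1 / 2" "1 / 2"] op_powr_zero[OF A x] by simp
  moreover have "B x \<in> vecs H"
    using AB x by (auto simp: form_ratio_def loewner_le_def intro: selfadjoint_op_vecs)
  ultimately have "ip H (rel_op H A B ?y) ?y = ip H (B x) x"
    using selfadjoint_opD(2)[OF op_powr_selfadjoint[OF A, of "- 1 / 2"], of "B x" ?y] y
    by (simp add: rel_op_def)
  then show ?thesis
    using quad_perspective[OF AB continuous_on_id x]
      fun_calc_ident[OF form_range_rel_op[OF AB] y] by (simp add: id_def)
qed

end

section \<open>From operator concavity to concavity\<close>

text \<open>The complex line, realised inside a function type; \<open>undefined\<close> is just some fixed index.\<close>

definition line_space :: "('i \<Rightarrow> complex) chilbert" where
  "line_space = \<lparr>vecs = {g. \<forall>i. i \<noteq> undefined \<longrightarrow> g i = 0},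
    scl = (\<lambda>c g i. c * g i), ip = (\<lambda>g h. g undefined * cnj (h undefined))\<rparr>"

lemma vecs_line_space: "vecs (line_space :: ('i \<Rightarrow> complex) chilbert) = {g. \<forall>i. i \<noteq> undefined \<longrightarrow> g i = 0}"
  and scl_line_space: "scl line_space = (\<lambda>c g i. c * g i)"
  and ip_line_space: "ip line_space = (\<lambda>g h. g undefined * cnj (h undefined))"
  by (auto simp: line_space_def)

lemma hnorm_line_space: "hnorm line_space g = cmod (g undefined)"
  by (simp add: hnorm_def ip_line_space complex_norm_square[symmetric] del: of_real_power)

lemma hilbert_space_line_space: "hilbert_space (line_space :: ('i \<Rightarrow> complex) chilbert)"
proof
  have vs: "vector_space (scl (line_space :: ('i \<Rightarrow> complex) chilbert))"
    by standard (auto simp: scl_line_space fun_eq_iff algebra_simps)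
  have "\<exists>l\<in>vecs (line_space :: ('i \<Rightarrow> complex) chilbert). (\<lambda>i. hnorm line_space (s i - l)) \<longlonglongrightarrow> 0"
    if cauchy: "\<forall>e>0. \<exists>N. \<forall>i\<ge>N. \<forall>j\<ge>N. hnorm (line_space :: ('i \<Rightarrow> complex) chilbert) (s i - s j) < e"
    for s :: "nat \<Rightarrow> 'i \<Rightarrow> complex"
  proof -
    have "Cauchy (\<lambda>i. s i undefined)"
      using cauchy by (simp add: Cauchy_def dist_norm hnorm_line_space)
    then obtain c where "(\<lambda>i. s i undefined) \<longlonglongrightarrow> c"
      using Cauchy_convergent_iff convergent_def by blast
    then have "(\<lambda>i. cmod (s i undefined - c)) \<longlonglongrightarrow> 0"
      by (simp add: LIM_zero_iff tendsto_norm_zero_iff)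
    then show ?thesis
      by (intro bexI[of _ "\<lambda>i. if i = undefined then c else 0"])
        (auto simp: hnorm_line_space vecs_line_space)
  qed
  moreover have "module.subspace (scl line_space) (vecs (line_space :: ('i \<Rightarrow> complex) chilbert))"
    using vs by (subst module.subspace_def)
      (auto simp: vector_space_def module_def vecs_line_space scl_line_space)
  moreover have "0 < Re (ip line_space g g)"
    if g: "g \<in> vecs line_space" "g \<noteq> 0" for g :: "'i \<Rightarrow> complex"
  proof -
    have "g undefined \<noteq> 0"
    proof
      assume "g undefined = 0"
      then have "g = 0" using g(1) by (auto simp: vecs_line_space fun_eq_iff) metis
      then show False using g(2) by simp
    qed
    then show ?thesis
      by (simp add: ip_line_space complex_norm_square[symmetric] del: of_real_power)
  qed
  ultimately show "complex_hilbert_space (line_space :: ('i \<Rightarrow> complex) chilbert)"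
    using vs unfolding complex_hilbert_space_def
    by (auto simp: ip_line_space scl_line_space algebra_simps)
qed

text \<open>
  On a line every operator is a scalar \<open>s\<close>, and \<open>f\<close> of it is the scalar \<open>f s\<close>; operator concavity
  there is concavity of \<open>f\<close>.
\<close>

lemma operator_concave_imp_concave:
  assumes f: "operator_concave TYPE('i \<Rightarrow> complex) J f"
    and s: "s \<in> J" and t: "t \<in> J" and l: "0 \<le> l" "l \<le> 1"
  shows "l * f s + (1 - l) * f t \<le> f (l * s + (1 - l) * t)"
proof -
  let ?K = "line_space :: ('i \<Rightarrow> complex) chilbert"
  interpret K: hilbert_space ?K by (rule hilbert_space_line_space)
  define X where "X r = op_scale ?K r id" for r
  define v :: "'i \<Rightarrow> complex" where "v = (\<lambda>i. if i = undefined then 1 else 0)"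
  have v: "v \<in> vecs ?K" by (simp add: v_def vecs_line_space)
  have v_undefined: "v undefined = 1" by (simp add: v_def)
  have X_apply: "X r = scl ?K (of_real r)" for r
    by (simp add: X_def op_scale_def fun_eq_iff)
  have sa: "selfadjoint_op ?K (X r)" for r
    unfolding X_def by (intro K.selfadjoint_op_op_scale K.selfadjoint_op_id)
  have range: "K.form_range (X r) r r" for r
    using sa[of r] by (simp add: K.form_range_def X_def K.quad_op_scale[OF K.selfadjoint_op_id] K.hnorm_square)
  have spectrum: "op_spectrum ?K (X r) \<subseteq> complex_of_real ` J" if "r \<in> J" for r
  proof
    fix z assume z: "z \<in> op_spectrum ?K (X r)"
    have "z = of_real r"
    proof (rule ccontr)
      assume ne: "z \<noteq> of_real r"
      have bd: "bounded_op ?K (scl ?K c)" for c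
        by (rule K.bounded_opI[where b = "cmod c"])
          (auto simp: K.hnorm_scl K.scaling.scale_right_distrib mult.commute)
      have "invertible_op ?K (scl ?K (of_real r - z))"
        unfolding invertible_op_def
        using ne by (intro conjI exI[of _ "scl ?K (1 / (of_real r - z))"] bd) auto
      then have "invertible_op ?K (\<lambda>x. X r x - scl ?K z x)"
        by (rule K.invertible_op_cong) (simp add: X_apply K.scaling.scale_left_diff_distrib)
      then show False using z by (simp add: op_spectrum_def)
    qed
    then show "z \<in> complex_of_real ` J" using that by blast
  qed
  have calc: "fun_calc ?K f (X r) v = scl ?K (of_real (f r)) v" for r
  proof -
    have "fun_calc ?K f (X r) = fun_calc ?K (\<lambda>t. f r) (X r)"
      by (rule K.fun_calc_cong[OF range]) auto
    then show ?thesis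
      using K.fun_calc_const[OF range v] by simp
  qed
  have mix: "op_scale ?K l (X s) + op_scale ?K (1 - l) (X t) = X (l * s + (1 - l) * t)"
    by (rule ext) (simp add: X_def op_scale_def K.scaling.scale_left_distrib)
  have "loewner_le ?K (op_scale ?K l (fun_calc ?K f (X s)) + op_scale ?K (1 - l) (fun_calc ?K f (X t)))
      (fun_calc ?K f (op_scale ?K l (X s) + op_scale ?K (1 - l) (X t)))"
    using f K.hilbert sa spectrum s t l unfolding operator_concave_def by blast
  then have "Re (ip ?K ((op_scale ?K l (fun_calc ?K f (X s)) +
        op_scale ?K (1 - l) (fun_calc ?K f (X t))) v) v) \<le>
      Re (ip ?K (fun_calc ?K f (X (l * s + (1 - l) * t)) v) v)"
    using v unfolding mix K.loewner_le_iff by blast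
  then show ?thesis
    using v_undefined by (simp add: op_scale_def calc ip_line_space scl_line_space)
qed

section \<open>The chord of a concave function\<close>

text \<open>
  The half-line is open, so that every point \<open>s\<close> of it is a convex combination, with a positive weight
  on a point where \<open>f\<close> is positive.
\<close>

lemma concave_pos:
  fixes f :: "real \<Rightarrow> real"
  assumes concave: "\<And>s t l. 0 < s \<Longrightarrow> 0 < t \<Longrightarrow> 0 \<le> l \<Longrightarrow> l \<le> 1 \<Longrightarrow>
      l * f s + (1 - l) * f t \<le> f (l * s + (1 - l) * t)"
    and nonneg: "\<And>t. 0 < t \<Longrightarrow> 0 \<le> f t" and nonzero: "\<exists>t>0. f t \<noteq> 0" and s: "0 < s"
  shows "0 < f s"
proof -
  obtain t where t: "0 < t" "0 < f t"
    using nonzero nonneg by force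
  \<comment> \<open>The point \<open>u\<close> is taken beyond \<open>s\<close> as seen from \<open>t\<close>.\<close>
  obtain u l where u: "0 < u" and l: "0 < l" "l \<le> 1" and s_eq: "s = l * t + (1 - l) * u"
  proof (cases "s \<le> t")
    case True
    show thesis
    proof (rule that[of "s / 2" "s / (2 * t - s)"])
      show "s / (2 * t - s) \<le> 1" using True s by (simp add: field_simps)
      show "s = s / (2 * t - s) * t + (1 - s / (2 * t - s)) * (s / 2)"
        using True s by (simp add: divide_simps) (simp add: algebra_simps)
    qed (use True s in auto)
  next
    case False
    show thesis
    proof (rule that[of "2 * s" "s / (2 * s - t)"])
      show "s / (2 * s - t) \<le> 1" using False s by (simp add: field_simps)
      show "s = s / (2 * s - t) * t + (1 - s / (2 * s - t)) * (2 * s)"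
        using False s by (simp add: divide_simps) (simp add: algebra_simps)
    qed (use False s in auto)
  qed
  have "0 < l * f t" using l t by simp
  also have "\<dots> \<le> l * f t + (1 - l) * f u" using l nonneg[OF u] by simp
  also have "\<dots> \<le> f s" unfolding s_eq using t u l by (intro concave) auto
  finally show ?thesis .
qed

lemma chord_eq_convex_combination:
  assumes "m < M"
  shows "chord_slope f m M * t + chord_intercept f m M =
    (t - m) / (M - m) * f M + (1 - (t - m) / (M - m)) * f m"
  using assms by (simp add: chord_slope_def chord_intercept_def divide_simps) (simp add: algebra_simps)

text \<open>Compactness of the interval provides the greatest ratio that \<open>chord_ratio\<close> refers to.\<close>

lemma chord_ratio_attained:
  assumes f: "continuous_on {m..M} f" and le: "m \<le> M"
    and pos: "\<And>t. t \<in> {m..M} \<Longrightarrow> 0 < chord_slope f m M * t + chord_intercept f m M"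
  shows "\<exists>t\<in>{m..M}. chord_ratio f m M = f t / (chord_slope f m M * t + chord_intercept f m M)"
    and "\<And>t. t \<in> {m..M} \<Longrightarrow> f t \<le> chord_ratio f m M * (chord_slope f m M * t + chord_intercept f m M)"
proof -
  let ?g = "\<lambda>t. f t / (chord_slope f m M * t + chord_intercept f m M)"
  have "continuous_on {m..M} ?g"
  proof (intro continuous_intros f ballI)
    fix t assume "t \<in> {m..M}"
    then show "chord_slope f m M * t + chord_intercept f m M \<noteq> 0" using pos[of t] by simp
  qed
  then obtain t1 where t1: "t1 \<in> {m..M}" "\<And>t. t \<in> {m..M} \<Longrightarrow> ?g t \<le> ?g t1"
    using continuous_attains_sup[of "{m..M}" ?g] le by auto
  have eq: "chord_ratio f m M = ?g t1"
    unfolding chord_ratio_def by (rule Greatest_equality) (use t1 in auto)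
  then show "\<exists>t\<in>{m..M}. chord_ratio f m M = ?g t"
    using t1(1) by blast
  show "f t \<le> chord_ratio f m M * (chord_slope f m M * t + chord_intercept f m M)"
    if t: "t \<in> {m..M}" for t
    using t1(2)[OF t] pos[OF t] by (simp add: eq pos_divide_le_eq)
qed


section \<open>The reverse inequality for the relative entropy\<close>

theorem corollary3p3:
  fixes H :: "'h::ab_group_add chilbert"
    and A B :: "nat \<Rightarrow> 'h \<Rightarrow> 'h"
    and n :: nat
    and f :: "real \<Rightarrow> real"
    and m M t0 p :: real
  assumes "complex_hilbert_space H"
    and "1 \<le> n"
    and "\<forall>j\<in>{1..n}. strictly_positive_op H (A j)"
    and "\<forall>j\<in>{1..n}. strictly_positive_op H (B j)"
    and "0 < m" and "m < 1" and "1 < M"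
    and "\<forall>j\<in>{1..n}. loewner_le H (op_scale H m (A j)) (B j)"
    and "\<forall>j\<in>{1..n}. loewner_le H (B j) (op_scale H M (A j))"
    and "\<forall>x\<in>vecs H. (\<Sum>j=1..n. A j) x = id x"
    and "\<forall>x\<in>vecs H. (\<Sum>j=1..n. B j) x = id x"
    and "operator_concave TYPE(nat + 'h \<Rightarrow> complex) {0<..} f"
    and "\<forall>t>0. 0 \<le> f t"
    and "\<exists>t>0. f t \<noteq> 0"
    and "t0 \<in> {m..M}"
    and "p \<in> {0..1}"
  shows
    "loewner_le H
       (fun_calc H f
          ((\<Sum>j=1..n. natural_mean H (p + 1) (A j) (B j))
            + op_scale H t0 (id - (\<Sum>j=1..n. natural_mean H p (A j) (B j))))
        - op_scale H (chord_ratio f m M * f t0)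
            (id - (\<Sum>j=1..n. natural_mean H p (A j) (B j))))
       (op_scale H (chord_ratio f m M) (rel_entropy_seq H f p n A B))"
proof -
  interpret hilbert_space H by standard (rule assms(1))
  define \<mu> \<nu> \<gamma> where "\<mu> = chord_slope f m M" and "\<nu> = chord_intercept f m M"
    and "\<gamma> = chord_ratio f m M"
  have t0: "m \<le> t0" "t0 \<le> M" and p: "0 \<le> p" "p \<le> 1" and m: "0 < m" and mM: "m < M"
    using assms by auto
  have pos_on: "0 < t" if "t \<in> {m..M}" for t using that m by auto

  have concave: "l * f s + (1 - l) * f t \<le> f (l * s + (1 - l) * t)"
    if "0 < s" "0 < t" "0 \<le> l" "l \<le> 1" for s t l
    using operator_concave_imp_concave[OF assms(12)] that by simp
  have f_pos: "0 < f t" if "0 < t" for t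
    using concave_pos[of f t] concave assms(13,14) that by blast
  have "continuous_on {0<..} f"
    using assms(12) by (simp add: operator_concave_def)
  then have f_cont: "continuous_on {m..M} f"
    by (rule continuous_on_subset) (use m in auto)
  have weight: "0 \<le> (t - m) / (M - m)" "(t - m) / (M - m) \<le> 1" if "t \<in> {m..M}" for t
    using that mM by (auto simp: divide_simps)
  have chord_le: "\<mu> * t + \<nu> \<le> f t" if t: "t \<in> {m..M}" for t
  proof -
    have "(t - m) / (M - m) * M + (1 - (t - m) / (M - m)) * m = t"
      using mM by (simp add: divide_simps) (simp add: algebra_simps)
    then show ?thesis
      unfolding \<mu>_def \<nu>_def chord_eq_convex_combination[OF mM]
      using concave[of M m "(t - m) / (M - m)"] weight[OF t] m mM by simp
  qed
  have chord_pos: "0 < \<mu> * t + \<nu>" if t: "t \<in> {m..M}" for t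
  proof -
    let ?l = "(t - m) / (M - m)"
    have "0 < min (f M) (f m)" using f_pos m mM by simp
    also have "\<dots> = ?l * min (f M) (f m) + (1 - ?l) * min (f M) (f m)"
      by (simp add: algebra_simps)
    also have "\<dots> \<le> ?l * f M + (1 - ?l) * f m"
      using weight[OF t] by (intro add_mono mult_left_mono) auto
    finally show ?thesis
      unfolding \<mu>_def \<nu>_def chord_eq_convex_combination[OF mM] .
  qed
  have \<gamma>_chord: "f t \<le> \<gamma> * \<mu> * t + \<gamma> * \<nu>" if "t \<in> {m..M}" for t
    using chord_ratio_attained(2)[OF f_cont] chord_pos mM that
    by (simp add: \<mu>_def \<nu>_def \<gamma>_def algebra_simps)
  have \<gamma>_nonneg: "0 \<le> \<gamma>"
  proof -
    obtain t where t: "t \<in> {m..M}" "\<gamma> = f t / (\<mu> * t + \<nu>)"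
      using chord_ratio_attained(1)[OF f_cont] chord_pos mM
      unfolding \<mu>_def \<nu>_def \<gamma>_def by (auto simp: less_imp_le)
    then show ?thesis using chord_pos[OF t(1)] f_pos[OF pos_on[OF t(1)]] by simp
  qed

  have AB: "form_ratio (A j) (B j) m M" if "j \<in> {1..n}" for j
    using that assms(3,8,9) by (simp add: form_ratio_def)
  have saA: "selfadjoint_op H (A j)" and saB: "selfadjoint_op H (B j)" if "j \<in> {1..n}" for j
    using that assms(3,4) by (auto simp: strictly_positive_op_def positive_op_def)
  define S where "S h x = (\<Sum>j=1..n. Re (ip H (perspective h (A j) (B j) x) x))" for h x
  have S_mono: "S h x \<le> S k x"
    if "continuous_on {m..M} h" "continuous_on {m..M} k" "\<And>t. t \<in> {m..M} \<Longrightarrow> h t \<le> k t"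
      "x \<in> vecs H" for h k x
    unfolding S_def using that by (intro sum_mono quad_perspective_mono[OF AB]) auto
  have S_lincomb: "S (\<lambda>t. c * h t + d * k t) x = c * S h x + d * S k x"
    if "continuous_on {m..M} h" "continuous_on {m..M} k" "x \<in> vecs H" for h k x c d
    unfolding S_def sum_distrib_left sum.distrib[symmetric]
    by (intro sum.cong refl quad_perspective_lincomb[OF AB] that)
  have S_one: "S (\<lambda>t. 1) x = (hnorm H x)\<^sup>2" if x: "x \<in> vecs H" for x
  proof -
    have "S (\<lambda>t. 1) x = (\<Sum>j=1..n. Re (ip H (A j x) x))"
      unfolding S_def by (intro sum.cong refl quad_perspective_one[OF AB x])
    also have "\<dots> = Re (ip H ((\<Sum>j=1..n. A j) x) x)"
      using saA x by (intro quad_sum[symmetric])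
    finally show ?thesis using assms(10) x by (simp add: hnorm_square)
  qed
  have S_ident: "S (\<lambda>t. t) x = (hnorm H x)\<^sup>2" if x: "x \<in> vecs H" for x
  proof -
    have "S (\<lambda>t. t) x = (\<Sum>j=1..n. Re (ip H (B j x) x))"
      unfolding S_def by (intro sum.cong refl quad_perspective_ident[OF AB x])
    also have "\<dots> = Re (ip H ((\<Sum>j=1..n. B j) x) x)"
      using saB x by (intro quad_sum[symmetric])
    finally show ?thesis using assms(11) x by (simp add: hnorm_square)
  qed
  have powr_cont: "continuous_on {m..M} (\<lambda>t. t powr q)" for q
    using m by (rule continuous_on_powr_Icc)
  have powr_Suc: "t powr (p + 1) = t * t powr p" if "t \<in> {m..M}" for t
    using pos_on[OF that] by (simp add: powr_add)

  define G where "G q = (\<Sum>j=1..n. natural_mean H q (A j) (B j))" for q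
  have saG: "selfadjoint_op H (G q)" for q
    unfolding G_def natural_mean_eq_perspective
    by (intro selfadjoint_op_sum perspective_selfadjoint[OF AB] powr_cont)
  have quadG: "Re (ip H (G q x) x) = S (\<lambda>t. t powr q) x" if "x \<in> vecs H" for q x
    unfolding G_def S_def natural_mean_eq_perspective
    using that by (intro quad_sum perspective_selfadjoint[OF AB] powr_cont)

  define D where "D = id - G p"
  have saD: "selfadjoint_op H D"
    unfolding D_def by (intro selfadjoint_op_minus selfadjoint_op_id saG)
  have quadD: "Re (ip H (D x) x) = (hnorm H x)\<^sup>2 - S (\<lambda>t. t powr p) x" if x: "x \<in> vecs H" for x
    unfolding D_def using quad_minus[OF selfadjoint_op_id saG x] quad_id[OF x] quadG[OF x] by simp
  \<comment> \<open>The weighted arithmetic-geometric mean inequality \<open>t\<^sup>p \<le> (1 - p) + p t\<close>.\<close>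
  have D_nonneg: "0 \<le> Re (ip H (D x) x)" if x: "x \<in> vecs H" for x
  proof -
    have "S (\<lambda>t. t powr p) x \<le> S (\<lambda>t. (1 - p) * 1 + p * t) x"
    proof (rule S_mono)
      fix t assume "t \<in> {m..M}"
      then show "t powr p \<le> (1 - p) * 1 + p * t"
        using Youngs_inequality_0[of "1 - p" p 1 t] p pos_on by simp
    qed (use x in \<open>auto intro!: powr_cont continuous_intros\<close>)
    also have "\<dots> = (1 - p) * S (\<lambda>t. 1) x + p * S (\<lambda>t. t) x"
      using x by (intro S_lincomb continuous_intros)
    finally show ?thesis
      using S_one[OF x] S_ident[OF x] quadD[OF x] by (simp add: algebra_simps)
  qed

  define Z where "Z = G (p + 1) + op_scale H t0 D"
  have saZ: "selfadjoint_op H Z"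
    unfolding Z_def by (intro selfadjoint_op_plus selfadjoint_op_op_scale saG saD)
  have quadZ: "Re (ip H (Z x) x) = S (\<lambda>t. t powr (p + 1)) x + t0 * Re (ip H (D x) x)"
    if x: "x \<in> vecs H" for x
    unfolding Z_def
    using quad_plus[OF saG selfadjoint_op_op_scale[OF saD] x] quad_op_scale[OF saD x] quadG[OF x]
    by simp
  \<comment> \<open>\<open>Z\<close> is a noncommutative average of values in \<open>[m, M]\<close>: the weights \<open>A\<^sub>j \<natural>\<^sub>p B\<^sub>j\<close> and \<open>D\<close> sum to
    the identity.\<close>
  have Z_range: "form_range Z m M"
    unfolding form_range_def
  proof (intro conjI ballI saZ)
    fix x assume x: "x \<in> vecs H"
    have weights: "(hnorm H x)\<^sup>2 = S (\<lambda>t. t powr p) x + Re (ip H (D x) x)"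
      using quadD[OF x] by simp
    have scale: "S (\<lambda>t. c * t powr p + 0 * t powr p) x = c * S (\<lambda>t. t powr p) x" for c
      using S_lincomb[OF powr_cont powr_cont x, of c p 0 p] by simp
    have "m * S (\<lambda>t. t powr p) x \<le> S (\<lambda>t. t powr (p + 1)) x"
      unfolding scale[symmetric] using x
      by (intro S_mono continuous_intros powr_cont) (auto simp: powr_Suc intro: mult_right_mono)
    moreover have "m * Re (ip H (D x) x) \<le> t0 * Re (ip H (D x) x)"
      using t0 D_nonneg[OF x] by (intro mult_right_mono)
    ultimately show "m * (hnorm H x)\<^sup>2 \<le> Re (ip H (Z x) x)"
      unfolding weights quadZ[OF x] by (simp add: distrib_left)
    have "S (\<lambda>t. t powr (p + 1)) x \<le> M * S (\<lambda>t. t powr p) x"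
      unfolding scale[symmetric] using x
      by (intro S_mono continuous_intros powr_cont) (auto simp: powr_Suc intro: mult_right_mono)
    moreover have "t0 * Re (ip H (D x) x) \<le> M * Re (ip H (D x) x)"
      using t0 D_nonneg[OF x] by (intro mult_right_mono)
    ultimately show "Re (ip H (Z x) x) \<le> M * (hnorm H x)\<^sup>2"
      unfolding weights quadZ[OF x] by (simp add: distrib_left)
  qed
  have saF: "selfadjoint_op H (fun_calc H f Z)"
    using Z_range f_cont by (rule fun_calc_selfadjoint)
  have upper: "Re (ip H (fun_calc H f Z x) x) \<le> \<gamma> * \<mu> * Re (ip H (Z x) x) + \<gamma> * \<nu> * (hnorm H x)\<^sup>2"
    if x: "x \<in> vecs H" for x
  proof -
    have "Re (ip H (fun_calc H f Z x) x) \<le> Re (ip H (fun_calc H (\<lambda>t. \<gamma> * \<mu> * t + \<gamma> * \<nu> * 1) Z x) x)"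
      using \<gamma>_chord by (intro fun_calc_mono[OF Z_range f_cont _ _ x] continuous_intros) simp
    also have "fun_calc H (\<lambda>t. \<gamma> * \<mu> * t + \<gamma> * \<nu> * 1) Z x =
        scl H (of_real (\<gamma> * \<mu>)) (Z x) + scl H (of_real (\<gamma> * \<nu>)) x"
      using fun_calc_lincomb[OF Z_range continuous_on_id continuous_on_const x, of "\<gamma> * \<mu>" "\<gamma> * \<nu>" 1]
        fun_calc_ident[OF Z_range x] fun_calc_const[OF Z_range x, of 1] by (simp add: id_def)
    also have "Re (ip H \<dots> x) = \<gamma> * \<mu> * Re (ip H (Z x) x) + \<gamma> * \<nu> * (hnorm H x)\<^sup>2"
      using x selfadjoint_op_vecs[OF saZ x] by (simp add: ip_simps hnorm_square del: of_real_mult)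
    finally show ?thesis .
  qed

  define E where "E = rel_entropy_seq H f p n A B"
  have entropy_cont: "continuous_on {m..M} (\<lambda>t. t powr p * f t)"
    by (intro continuous_on_mult powr_cont f_cont)
  have sa_entropy: "selfadjoint_op H (rel_entropy H f p (A j) (B j))" if j: "j \<in> {1..n}" for j
    by (rule selfadjoint_op_cong[OF perspective_selfadjoint[OF AB[OF j] entropy_cont]])
      (rule rel_entropy_eq_perspective[OF AB[OF j] m f_cont])
  have saE: "selfadjoint_op H E"
    unfolding E_def rel_entropy_seq_def by (intro selfadjoint_op_sum sa_entropy)
  have quadE: "Re (ip H (E x) x) = S (\<lambda>t. t powr p * f t) x" if x: "x \<in> vecs H" for x
  proof -
    have "Re (ip H (E x) x) = (\<Sum>j=1..n. Re (ip H (rel_entropy H f p (A j) (B j) x) x))"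
      unfolding E_def rel_entropy_seq_def using sa_entropy x by (intro quad_sum)
    then show ?thesis
      using rel_entropy_eq_perspective[OF AB m f_cont x] by (simp add: S_def)
  qed
  have lower: "\<mu> * S (\<lambda>t. t powr (p + 1)) x + \<nu> * S (\<lambda>t. t powr p) x \<le> Re (ip H (E x) x)"
    if x: "x \<in> vecs H" for x
  proof -
    have "\<mu> * S (\<lambda>t. t powr (p + 1)) x + \<nu> * S (\<lambda>t. t powr p) x =
        S (\<lambda>t. \<mu> * t powr (p + 1) + \<nu> * t powr p) x"
      using S_lincomb[OF powr_cont powr_cont x] by simp
    also have "\<dots> \<le> S (\<lambda>t. t powr p * f t) x"
    proof (rule S_mono[OF _ entropy_cont _ x])
      fix t assume t: "t \<in> {m..M}"
      have "t powr p * (\<mu> * t + \<nu>) \<le> t powr p * f t"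
        using chord_le[OF t] by (intro mult_left_mono) auto
      then show "\<mu> * t powr (p + 1) + \<nu> * t powr p \<le> t powr p * f t"
        unfolding powr_Suc[OF t] by (simp add: algebra_simps)
    qed (intro continuous_intros powr_cont)
    finally show ?thesis using quadE[OF x] by simp
  qed

  have "loewner_le H (fun_calc H f Z - op_scale H (\<gamma> * f t0) D) (op_scale H \<gamma> E)"
    unfolding loewner_le_iff
  proof (intro conjI ballI selfadjoint_op_minus selfadjoint_op_op_scale saF saD saE)
    fix x assume x: "x \<in> vecs H"
    define d where "d = Re (ip H (D x) x)"
    define u v where "u = S (\<lambda>t. t powr (p + 1)) x" and "v = S (\<lambda>t. t powr p) x"
    have "(\<mu> * t0 + \<nu>) * d \<le> f t0 * d"
      unfolding d_def using chord_le[of t0] t0 D_nonneg[OF x] by (intro mult_right_mono) auto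
    then have "\<mu> * (u + t0 * d) + \<nu> * (v + d) - f t0 * d \<le> Re (ip H (E x) x)"
      using lower[OF x] unfolding u_def v_def by (simp add: algebra_simps)
    then have "\<gamma> * (\<mu> * (u + t0 * d) + \<nu> * (v + d) - f t0 * d) \<le> \<gamma> * Re (ip H (E x) x)"
      using \<gamma>_nonneg by (rule mult_left_mono)
    moreover have "Re (ip H (fun_calc H f Z x) x) \<le> \<gamma> * \<mu> * (u + t0 * d) + \<gamma> * \<nu> * (v + d)"
      using upper[OF x] quadZ[OF x] quadD[OF x] unfolding u_def v_def d_def by simp
    moreover have "Re (ip H ((fun_calc H f Z - op_scale H (\<gamma> * f t0) D) x) x) =
        Re (ip H (fun_calc H f Z x) x) - \<gamma> * f t0 * d"
      unfolding quad_minus[OF saF selfadjoint_op_op_scale[OF saD] x] quad_op_scale[OF saD x] d_def ..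
    moreover have "Re (ip H (op_scale H \<gamma> E x) x) = \<gamma> * Re (ip H (E x) x)"
      using saE x by (rule quad_op_scale)
    ultimately show "Re (ip H ((fun_calc H f Z - op_scale H (\<gamma> * f t0) D) x) x) \<le>
        Re (ip H (op_scale H \<gamma> E x) x)"
      by (simp add: algebra_simps)
  qed
  then show ?thesis
    unfolding Z_def D_def G_def E_def \<gamma>_def .
qed

end
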